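(* Let $\mathscr{A}$ be a Banach algebra and $\eta$ an infinite cardinal number. Suppose that $\mathscr{A}$ contains two bounded subsets $A=\{a_\alpha:\alpha\in\Lambda_1\}$ and $B=\{b_\beta:\beta\in\Lambda_2\}$ indexed, respectively, by two cofinal subsets $\Lambda_1$ and $\Lambda_2$ of a common directed set $(\Lambda,\preceq)$ with $\mathrm{tr}|\Lambda_1|=\mathrm{tr}|\Lambda_2|=\eta$. Suppose as well that $\mathscr{A}$ contains two other disjoint sets $X_1$ and $X_2$ with the following properties: (i) $X=X_1\cup X_2$ is an $\ell^1(\eta)$-base in $\mathscr{A}$ with constant $K>0$, contained in the ball of radius $M>0$. (ii) $X_1$ and $X_2$ approximate segments in $T^u_{AB}$ and $T^l_{AB}$, respectively. (iii) Either $X_1$ is vertically injective and $X_2$ is horizontally injective, or vice versa (with respect to the double-indexings of $X_1$, $X_2$ used in (ii)). Then there is a bounded linear map of $\mathscr{A}^*/\mathscr{WAP}(\mathscr{A})$ onto $\ell^\infty(\eta)$. If, in addition, $d(\mathscr{A})\le\eta$, then $\mathscr{A}$ is extremely non-Arens regular.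
   Context: $\mathscr{A}^*$ is the Banach dual of $\mathscr{A}$. For $f\in\mathscr{A}^*$, $\varphi\in\mathscr{A}$, $f\varphi\in\mathscr{A}^*$ is given by $\langle f\varphi,\psi\rangle=\langle f,\varphi\psi\rangle$. $\mathscr{WAP}(\mathscr{A})$ (weakly almost periodic functionals) is the closed subspace of all $f\in\mathscr{A}^*$ such that $\{f\varphi:\varphi\in\mathscr{A},\|\varphi\|\le 1\}$ is relatively weakly compact in $\mathscr{A}^*$. $\mathscr{A}$ is extremely non-Arens regular (enAr) if $\mathscr{A}^*/\mathscr{WAP}(\mathscr{A})$ contains a closed subspace that admits a surjective bounded linear map onto $\mathscr{A}^*$. $d(\mathscr{A})$ is the density character of $\mathscr{A}$: the least cardinality of a norm-dense subset. $\ell^1(\eta)$-base: a bounded set $B=\{a_\alpha:\alpha<\eta\}$ of cardinality $\eta$ ($\eta$ an infinite cardinal) in a normed space is an $\ell^1(\eta)$-base with constant $K>0$ if $\sum_{n=1}^p|z_n|\le K\|\sum_{n=1}^p z_na_{\alpha_n}\|$ for all $p\in\mathbb{N}$, all scalars $z_1,\dots,z_p$ and all distinct elements $a_{\alpha_1},\dots,a_{\alpha_p}$ of $B$. A directed set is a set with a preorder $\preceq$ in which every pair of elements has an upper bound; $\alpha\prec\beta$ means $\alpha\preceq\beta$ and $\alpha\ne\beta$. For a directed set $\Lambda$ and $\xi\in\Lambda$ put $\xi^+=\{\alpha\in\Lambda:\xi\prec\alpha\}$; the true cardinality is $\mathrm{tr}|\Lambda|=\min_{\xi\in\Lambda}|\xi^+|$.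 Cofinal subsets are directed by the induced preorder. A set $X$ is indexed by a set $\mathcal U$ if there is a surjection $\mathcal U\to X$; if $\mathcal U\subseteq\Lambda\times\Lambda$ we say $X$ is double-indexed by $\mathcal U$ and write $X=\{x_{\alpha\beta}:(\alpha,\beta)\in\mathcal U\}$. It is vertically injective if $x_{\alpha\beta}=x_{\alpha'\beta'}$ implies $\beta=\beta'$, and horizontally injective if $x_{\alpha\beta}=x_{\alpha'\beta'}$ implies $\alpha=\alpha'$. $\mathcal U\subseteq\Lambda_1\times\Lambda_2$ is vertically cofinal if for every $\alpha\in\Lambda_1$ there is $\beta_\alpha\in\Lambda_2$ with $(\alpha,\beta)\in\mathcal U$ for every $\beta\in\Lambda_2$, $\beta\succeq\beta_\alpha$; it is horizontally cofinal if for every $\beta\in\Lambda_2$ there is $\alpha_\beta\in\Lambda_1$ with $(\alpha,\beta)\in\mathcal U$ for every $\alpha\in\Lambda_1$, $\alpha\succeq\alpha_\beta$. The upper and lower triangles are $T^u_{AB}=\{a_\alpha b_\beta:(\alpha,\beta)\in\Lambda_1\times\Lambda_2,\alpha\prec\beta\}$ and $T^l_{AB}=\{a_\alpha b_\beta:(\alpha,\beta)\in\Lambda_1\times\Lambda_2,\beta\prec\alpha\}$. A set $X\subseteq\mathscr{A}$ approximates segments in $T^u_{AB}$ if it can be double-indexed as $X=\{x_{\alpha\beta}:(\alpha,\beta)\in\mathcal U\}$ by a vertically cofinal $\mathcal U\subseteq\Lambda_1\times\Lambda_2$ so that for each $\alpha\in\Lambda_1$, $\lim_{\beta\in\Lambda_2}\|x_{\alpha\beta}-a_\alpha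 b_\beta\|=0$. It approximates segments in $T^l_{AB}$ if it can be double-indexed as $X=\{x_{\alpha\beta}:(\alpha,\beta)\in\mathcal U\}$ by a horizontally cofinal $\mathcal U\subseteq\Lambda_1\times\Lambda_2$ so that for each $\beta\in\Lambda_2$, $\lim_{\alpha\in\Lambda_1}\|x_{\alpha\beta}-a_\alpha b_\beta\|=0$. (One may assume that $(\alpha,\beta)\in\mathcal U$ implies $\alpha\prec\beta$, respectively $\beta\prec\alpha$.) *)

theory Defs
  imports "HOL-Analysis.Analysis"
begin

unbundle cardinal_syntax

section \<open>Scalars and Banach algebras\<close>

text \<open>
  The scalar field is the real or the complex field. The class below consists of
  the normed fields that are isometrically isomorphic to one of the two, so that both cases are
  treated by one statement.
\<close>

class real_or_complex = real_normed_field +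
  assumes real_or_complex:
    "\<exists>\<phi>::'a \<Rightarrow> complex.
       (\<forall>x y. \<phi> (x + y) = \<phi> x + \<phi> y) \<and> (\<forall>x y. \<phi> (x * y) = \<phi> x * \<phi> y) \<and>
       (\<forall>r x. \<phi> (r *\<^sub>R x) = r *\<^sub>R \<phi> x) \<and> (\<forall>x. norm (\<phi> x) = norm x) \<and>
       (range \<phi> = \<real> \<or> range \<phi> = UNIV)"

instance real :: real_or_complex
  by standard (rule exI[of _ complex_of_real], auto simp: Reals_def scaleR_conv_of_real)

instance complex :: real_or_complex
  by standard (rule exI[of _ id], auto)

text \<open>
  Banach algebras need not be unital. The type class provides the norm, completeness,
  submultiplicativity and the underlying real structure; the parameter \<open>smul\<close> is the
  multiplication by scalars in \<open>'k\<close>. For \<open>'k = real\<close> this is just \<open>smul = scaleR\<close>.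
\<close>

locale banach_algebra = vector_space smul
  for smul :: "'k::real_or_complex \<Rightarrow> 'a::{real_normed_algebra, banach} \<Rightarrow> 'a" +
  assumes scale_of_real: "smul (of_real r) x = r *\<^sub>R x"
    and norm_scale: "norm (smul c x) = norm c * norm x"
    and mult_scale_left: "smul c x * y = smul c (x * y)"
    and mult_scale_right: "x * smul c y = smul c (x * y)"

lemma banach_algebra_scaleR:
  "banach_algebra (scaleR :: real \<Rightarrow> 'a \<Rightarrow> 'a::{real_normed_algebra, banach})"
  by unfold_locales (auto simp: algebra_simps)

lemma banach_algebra_complex: "banach_algebra ((*) :: complex \<Rightarrow> complex \<Rightarrow> complex)"
  by unfold_locales (auto simp: algebra_simps norm_mult scaleR_conv_of_real)


section \<open>Normed spaces with explicit carrier, duals, quotients\<close>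

text \<open>
  The dual and its quotients are handled as normed spaces over \<open>'k\<close> with an explicit carrier set.
  The library's bounded linear functions are only real-linear and live on whole types.
\<close>

record ('k, 'v) nspace =
  vcarrier :: "'v set"
  vadd :: "'v \<Rightarrow> 'v \<Rightarrow> 'v"
  vscale :: "'k \<Rightarrow> 'v \<Rightarrow> 'v"
  vnorm :: "'v \<Rightarrow> real"

definition type_space :: "('k \<Rightarrow> 'v \<Rightarrow> 'v) \<Rightarrow> ('k, 'v::real_normed_vector) nspace" where
  "type_space smul = \<lparr>vcarrier = UNIV, vadd = (+), vscale = smul, vnorm = norm\<rparr>"

definition bounded_linear_map ::
    "('k, 'v) nspace \<Rightarrow> ('k, 'w) nspace \<Rightarrow> ('v \<Rightarrow> 'w) \<Rightarrow> bool" where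
  "bounded_linear_map V W T \<longleftrightarrow>
     T ` vcarrier V \<subseteq> vcarrier W \<and>
     (\<forall>x\<in>vcarrier V. \<forall>y\<in>vcarrier V. T (vadd V x y) = vadd W (T x) (T y)) \<and>
     (\<forall>c. \<forall>x\<in>vcarrier V. T (vscale V c x) = vscale W c (T x)) \<and>
     (\<exists>C. \<forall>x\<in>vcarrier V. vnorm W (T x) \<le> C * vnorm V x)"

definition bounded_linear_onto ::
    "('k, 'v) nspace \<Rightarrow> ('k, 'w) nspace \<Rightarrow> ('v \<Rightarrow> 'w) \<Rightarrow> bool" where
  "bounded_linear_onto V W T \<longleftrightarrow>
     bounded_linear_map V W T \<and> T ` vcarrier V = vcarrier W"

definition closed_subspace :: "('k::real_or_complex, 'v) nspace \<Rightarrow> 'v set \<Rightarrow> bool" where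
  "closed_subspace V S \<longleftrightarrow>
     S \<subseteq> vcarrier V \<and> S \<noteq> {} \<and>
     (\<forall>x\<in>S. \<forall>y\<in>S. vadd V x y \<in> S) \<and>
     (\<forall>c. \<forall>x\<in>S. vscale V c x \<in> S) \<and>
     (\<forall>x\<in>vcarrier V.
        (\<forall>\<epsilon>>0. \<exists>s\<in>S. vnorm V (vadd V x (vscale V (- 1) s)) < \<epsilon>) \<longrightarrow> x \<in> S)"

definition restrict_space_to :: "('k, 'v) nspace \<Rightarrow> 'v set \<Rightarrow> ('k, 'v) nspace" where
  "restrict_space_to V S = V\<lparr>vcarrier := S\<rparr>"

text \<open>
  The Banach dual, with the operator norm. Functionals are normalised to be \<open>0\<close> outside the
  carrier, so that each functional is represented by exactly one function.
\<close>

definition dual_space :: "('k::real_or_complex, 'v) nspace \<Rightarrow> ('k, 'v \<Rightarrow> 'k) nspace" where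
  "dual_space V =
     \<lparr>vcarrier = {f. bounded_linear_map V (type_space (*)) f \<and> (\<forall>x. x \<notin> vcarrier V \<longrightarrow> f x = 0)},
      vadd = (\<lambda>f g x. f x + g x),
      vscale = (\<lambda>c f x. c * f x),
      vnorm = (\<lambda>f. SUP x\<in>{x\<in>vcarrier V. vnorm V x \<le> 1}. norm (f x))\<rparr>"

text \<open>
  The weak topology of \<open>V\<close>: the coarsest topology on the carrier that makes all elements of the
  dual continuous.
\<close>

definition weak_topology :: "('k::real_or_complex, 'v) nspace \<Rightarrow> 'v topology" where
  "weak_topology V =
     topology_generated_by
       {{x\<in>vcarrier V. \<phi> x \<in> G} | \<phi> G. \<phi> \<in> vcarrier (dual_space V) \<and> open G}"

definition relatively_weakly_compact :: "('k::real_or_complex, 'v) nspace \<Rightarrow> 'v set \<Rightarrow> bool" where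
  "relatively_weakly_compact V S \<longleftrightarrow>
     S \<subseteq> vcarrier V \<and> compactin (weak_topology V) (weak_topology V closure_of S)"

definition coset :: "('k, 'v) nspace \<Rightarrow> 'v set \<Rightarrow> 'v \<Rightarrow> 'v set" where
  "coset V W x = {vadd V x w | w. w \<in> W}"

text \<open>
  The quotient \<open>V / W\<close>, with the usual quotient norm. In the scalar multiple of a coset the
  summand \<open>w\<close> matters only for the scalar \<open>0\<close>.
\<close>

definition quotient_space :: "('k, 'v) nspace \<Rightarrow> 'v set \<Rightarrow> ('k, 'v set) nspace" where
  "quotient_space V W =
     \<lparr>vcarrier = coset V W ` vcarrier V,
      vadd = (\<lambda>C D. {vadd V x y | x y. x \<in> C \<and> y \<in> D}),
      vscale = (\<lambda>c C. {vadd V (vscale V c x) w | x w. x \<in> C \<and> w \<in> W}),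
      vnorm = (\<lambda>C. INF x\<in>C. vnorm V x)\<rparr>"

text \<open>
  A cardinal \<open>\<eta>\<close> is a cardinal order on its field, as in the cardinal library. The space
  \<open>\<ell>\<^sup>\<infinity>(\<eta>)\<close> consists of the bounded functions on \<open>Field \<eta>\<close>, extended by \<open>0\<close>.
\<close>

definition linfty :: "'c rel \<Rightarrow> ('k::real_or_complex, 'c \<Rightarrow> 'k) nspace" where
  "linfty \<eta> =
     \<lparr>vcarrier = {f. bounded (f ` Field \<eta>) \<and> (\<forall>i. i \<notin> Field \<eta> \<longrightarrow> f i = 0)},
      vadd = (\<lambda>f g i. f i + g i),
      vscale = (\<lambda>c f i. c * f i),
      vnorm = (\<lambda>f. SUP i\<in>Field \<eta>. norm (f i))\<rparr>"


section \<open>Weakly almost periodic functionals and extreme non-Arens regularity\<close>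

abbreviation algebra_dual ::
    "('k::real_or_complex \<Rightarrow> 'a::{real_normed_algebra, banach} \<Rightarrow> 'a) \<Rightarrow> ('k, 'a \<Rightarrow> 'k) nspace" where
  "algebra_dual smul \<equiv> dual_space (type_space smul)"

definition functional_act :: "('a::times \<Rightarrow> 'k) \<Rightarrow> 'a \<Rightarrow> 'a \<Rightarrow> 'k" where
  "functional_act f \<phi> = (\<lambda>\<psi>. f (\<phi> * \<psi>))"

definition WAP ::
    "('k::real_or_complex \<Rightarrow> 'a::{real_normed_algebra, banach} \<Rightarrow> 'a) \<Rightarrow> ('a \<Rightarrow> 'k) set" where
  "WAP smul =
     {f \<in> vcarrier (algebra_dual smul).
        relatively_weakly_compact (algebra_dual smul) {functional_act f \<phi> | \<phi>. norm \<phi> \<le> 1}}"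

definition extremely_non_Arens_regular ::
    "('k::real_or_complex \<Rightarrow> 'a::{real_normed_algebra, banach} \<Rightarrow> 'a) \<Rightarrow> bool" where
  "extremely_non_Arens_regular smul \<longleftrightarrow>
     (let Q = quotient_space (algebra_dual smul) (WAP smul) in
      \<exists>S. closed_subspace Q S \<and>
          (\<exists>T. bounded_linear_onto (restrict_space_to Q S) (algebra_dual smul) T))"


section \<open>Cardinal invariants\<close>

text \<open>The least cardinality of a member of a nonempty family of sets.\<close>

definition min_card :: "'b set set \<Rightarrow> 'b rel" where
  "min_card \<F> = card_of (SOME S. S \<in> \<F> \<and> (\<forall>S'\<in>\<F>. |S| \<le>o |S'| ))"

lemma min_card_attained:
  assumes "\<F> \<noteq> {}"
  obtains S where "S \<in> \<F>" "min_card \<F> = |S|" "\<And>S'. S' \<in> \<F> \<Longrightarrow> |S| \<le>o |S'|"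
proof -
  have "\<exists>r\<in>card_of ` \<F>. \<forall>r'\<in>card_of ` \<F>. r \<le>o r'"
    by (rule exists_minim_Card_order) (use assms in \<open>auto simp: card_of_Card_order\<close>)
  then have "\<exists>S. S \<in> \<F> \<and> (\<forall>S'\<in>\<F>. |S| \<le>o |S'| )"
    by auto
  from someI_ex[OF this] show thesis
    by (intro that[of "SOME S. S \<in> \<F> \<and> (\<forall>S'\<in>\<F>. |S| \<le>o |S'| )"]) (auto simp: min_card_def)
qed

text \<open>The density character of the ambient space \<open>'a\<close> is that of \<open>UNIV\<close>.\<close>

definition density_character :: "'a::metric_space set \<Rightarrow> 'a rel" where
  "density_character S = min_card {D. D \<subseteq> S \<and> S \<subseteq> closure D}"

definition l1_base ::
    "('k::real_or_complex \<Rightarrow> 'a::real_normed_vector \<Rightarrow> 'a) \<Rightarrow> 'c rel \<Rightarrow> real \<Rightarrow> 'a set \<Rightarrow> bool" where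
  "l1_base smul \<eta> K B \<longleftrightarrow>
     K > 0 \<and> bounded B \<and> |B| =o \<eta> \<and>
     (\<forall>F z. finite F \<and> F \<subseteq> B \<longrightarrow>
        (\<Sum>x\<in>F. norm (z x)) \<le> K * norm (\<Sum>x\<in>F. smul (z x) x))"


section \<open>Directed sets and approximation of segments\<close>

text \<open>
  Directed sets are nonempty, as is needed for the true cardinality to be defined. A subset of
  a directed set carries the induced preorder, so the ambient relation \<open>r\<close> is used throughout.
\<close>

definition directed_set :: "'i set \<Rightarrow> 'i rel \<Rightarrow> bool" where
  "directed_set \<Lambda> r \<longleftrightarrow>
     \<Lambda> \<noteq> {} \<and> preorder_on \<Lambda> r \<and> (\<forall>\<alpha>\<in>\<Lambda>. \<forall>\<beta>\<in>\<Lambda>. \<exists>\<gamma>\<in>\<Lambda>. (\<alpha>, \<gamma>) \<in> r \<and> (\<beta>, \<gamma>) \<in> r)"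

definition cofinal_subset :: "'i set \<Rightarrow> 'i rel \<Rightarrow> 'i set \<Rightarrow> bool" where
  "cofinal_subset \<Lambda> r \<Lambda>' \<longleftrightarrow> \<Lambda>' \<subseteq> \<Lambda> \<and> (\<forall>\<alpha>\<in>\<Lambda>. \<exists>\<beta>\<in>\<Lambda>'. (\<alpha>, \<beta>) \<in> r)"

definition strictly_above :: "'i set \<Rightarrow> 'i rel \<Rightarrow> 'i \<Rightarrow> 'i set" where
  "strictly_above \<Lambda> r \<xi> = {\<alpha>\<in>\<Lambda>. (\<xi>, \<alpha>) \<in> r \<and> \<xi> \<noteq> \<alpha>}"

definition true_cardinality :: "'i set \<Rightarrow> 'i rel \<Rightarrow> 'i rel" where
  "true_cardinality \<Lambda> r = min_card (strictly_above \<Lambda> r ` \<Lambda>)"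

definition tails_filter :: "'i set \<Rightarrow> 'i rel \<Rightarrow> 'i filter" where
  "tails_filter \<Lambda> r = (INF \<xi>\<in>\<Lambda>. principal {\<alpha>\<in>\<Lambda>. (\<xi>, \<alpha>) \<in> r})"

definition vertically_cofinal ::
    "'i rel \<Rightarrow> 'i set \<Rightarrow> 'i set \<Rightarrow> ('i \<times> 'i) set \<Rightarrow> bool" where
  "vertically_cofinal r \<Lambda>\<^sub>1 \<Lambda>\<^sub>2 U \<longleftrightarrow>
     U \<subseteq> \<Lambda>\<^sub>1 \<times> \<Lambda>\<^sub>2 \<and>
     (\<forall>\<alpha>\<in>\<Lambda>\<^sub>1. \<exists>\<beta>\<^sub>0\<in>\<Lambda>\<^sub>2. \<forall>\<beta>\<in>\<Lambda>\<^sub>2. (\<beta>\<^sub>0, \<beta>) \<in> r \<longrightarrow> (\<alpha>, \<beta>) \<in> U)"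

definition horizontally_cofinal ::
    "'i rel \<Rightarrow> 'i set \<Rightarrow> 'i set \<Rightarrow> ('i \<times> 'i) set \<Rightarrow> bool" where
  "horizontally_cofinal r \<Lambda>\<^sub>1 \<Lambda>\<^sub>2 U \<longleftrightarrow>
     U \<subseteq> \<Lambda>\<^sub>1 \<times> \<Lambda>\<^sub>2 \<and>
     (\<forall>\<beta>\<in>\<Lambda>\<^sub>2. \<exists>\<alpha>\<^sub>0\<in>\<Lambda>\<^sub>1. \<forall>\<alpha>\<in>\<Lambda>\<^sub>1. (\<alpha>\<^sub>0, \<alpha>) \<in> r \<longrightarrow> (\<alpha>, \<beta>) \<in> U)"

definition vertically_injective :: "('i \<times> 'i) set \<Rightarrow> ('i \<Rightarrow> 'i \<Rightarrow> 'a) \<Rightarrow> bool" where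
  "vertically_injective U x \<longleftrightarrow>
     (\<forall>(\<alpha>, \<beta>)\<in>U. \<forall>(\<alpha>', \<beta>')\<in>U. x \<alpha> \<beta> = x \<alpha>' \<beta>' \<longrightarrow> \<beta> = \<beta>')"

definition horizontally_injective :: "('i \<times> 'i) set \<Rightarrow> ('i \<Rightarrow> 'i \<Rightarrow> 'a) \<Rightarrow> bool" where
  "horizontally_injective U x \<longleftrightarrow>
     (\<forall>(\<alpha>, \<beta>)\<in>U. \<forall>(\<alpha>', \<beta>')\<in>U. x \<alpha> \<beta> = x \<alpha>' \<beta>' \<longrightarrow> \<alpha> = \<alpha>')"

definition double_indexed :: "'a set \<Rightarrow> ('i \<times> 'i) set \<Rightarrow> ('i \<Rightarrow> 'i \<Rightarrow> 'a) \<Rightarrow> bool" where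
  "double_indexed X U x \<longleftrightarrow> X = (\<lambda>(\<alpha>, \<beta>). x \<alpha> \<beta>) ` U"

text \<open>
  The set \<open>X\<close>, double-indexed by \<open>U\<close> through \<open>x\<close>, approximates segments in the upper (lower)
  triangle of \<open>a\<close> and \<open>b\<close>. The indexing is an argument because injectivity refers to the same
  indexing. The values of \<open>x\<close> outside \<open>U\<close> are irrelevant: by cofinality of \<open>U\<close> the limits only
  involve indices in \<open>U\<close>.
\<close>

definition approximates_upper_segments ::
    "'i rel \<Rightarrow> 'i set \<Rightarrow> 'i set \<Rightarrow> ('i \<Rightarrow> 'a) \<Rightarrow> ('i \<Rightarrow> 'a::real_normed_algebra) \<Rightarrow>
     'a set \<Rightarrow> ('i \<times> 'i) set \<Rightarrow> ('i \<Rightarrow> 'i \<Rightarrow> 'a) \<Rightarrow> bool" where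
  "approximates_upper_segments r \<Lambda>\<^sub>1 \<Lambda>\<^sub>2 a b X U x \<longleftrightarrow>
     double_indexed X U x \<and> vertically_cofinal r \<Lambda>\<^sub>1 \<Lambda>\<^sub>2 U \<and>
     (\<forall>\<alpha>\<in>\<Lambda>\<^sub>1. ((\<lambda>\<beta>. norm (x \<alpha> \<beta> - a \<alpha> * b \<beta>)) \<longlongrightarrow> 0) (tails_filter \<Lambda>\<^sub>2 r))"

definition approximates_lower_segments ::
    "'i rel \<Rightarrow> 'i set \<Rightarrow> 'i set \<Rightarrow> ('i \<Rightarrow> 'a) \<Rightarrow> ('i \<Rightarrow> 'a::real_normed_algebra) \<Rightarrow>
     'a set \<Rightarrow> ('i \<times> 'i) set \<Rightarrow> ('i \<Rightarrow> 'i \<Rightarrow> 'a) \<Rightarrow> bool" where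
  "approximates_lower_segments r \<Lambda>\<^sub>1 \<Lambda>\<^sub>2 a b X U x \<longleftrightarrow>
     double_indexed X U x \<and> horizontally_cofinal r \<Lambda>\<^sub>1 \<Lambda>\<^sub>2 U \<and>
     (\<forall>\<beta>\<in>\<Lambda>\<^sub>2. ((\<lambda>\<alpha>. norm (x \<alpha> \<beta> - a \<alpha> * b \<beta>)) \<longlongrightarrow> 0) (tails_filter \<Lambda>\<^sub>1 r))"

end

theory Submission
  imports Defs
begin

text \<open>
  Let \<open>U\<close> and \<open>V\<close> be ultrafilters refining the tails of the two index sets. A weakly almost
  periodic functional \<open>f\<close> has equal iterated limits of \<open>f (a\<^sub>\<alpha> b\<^sub>\<beta>)\<close> along \<open>U\<close> and \<open>V\<close>, because
  the functionals \<open>f a\<^sub>\<alpha>\<close> converge weakly along \<open>U\<close>. Hence the difference of the two iterated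
  limits is a functional on the dual that annihilates \<open>WAP\<close>.

  One index set contains \<open>\<eta>\<close> disjoint cofinal pieces; let the ultrafilter on it run through
  refinements of the pieces. This gives \<open>\<eta>\<close> such functionals, that is, a bounded map of
  \<open>\<A>\<^sup>* / WAP\<close> to \<open>\<ell>\<^sup>\<infinity>(\<eta>)\<close>. It is onto: if, say, \<open>X\<^sub>1\<close> is vertically injective, then \<open>x\<^sub>\<alpha>\<^sub>\<beta> \<in> X\<^sub>1\<close>
  determines \<open>\<beta>\<close>, and since \<open>X\<^sub>1 \<union> X\<^sub>2\<close> is an \<open>\<ell>\<^sup>1\<close>-base, some functional takes the value \<open>c\<^sub>i\<close>
  at \<open>x\<^sub>\<alpha>\<^sub>\<beta>\<close> for \<open>\<beta>\<close> in the \<open>i\<close>-th piece and vanishes on \<open>X\<^sub>2\<close>. Its iterated limits are \<open>c\<^sub>i\<close>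
  and \<open>0\<close>.

  If \<open>\<A>\<close> has a dense subset of cardinality at most \<open>\<eta>\<close>, evaluation on it embeds \<open>\<A>\<^sup>*\<close> in
  \<open>\<ell>\<^sup>\<infinity>(\<eta>)\<close>, and the preimage of \<open>\<A>\<^sup>*\<close> is the required closed subspace of the quotient.
\<close>

section \<open>The Hahn--Banach theorem\<close>

definition sublinear :: "('a::real_vector \<Rightarrow> real) \<Rightarrow> bool" where
  "sublinear p \<longleftrightarrow> (\<forall>x y. p (x + y) \<le> p x + p y) \<and> (\<forall>t x. t \<ge> 0 \<longrightarrow> p (t *\<^sub>R x) = t * p x)"

text \<open>One inequality for positive scalars suffices: applied to \<open>1 / t\<close> and the
  vector \<open>t *\<^sub>R x\<close> it gives the reverse one.\<close>

lemma sublinearI: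
  assumes add: "\<And>x y. p (x + y) \<le> p x + p y"
    and zero: "p 0 = 0"
    and scale: "\<And>t x. t > 0 \<Longrightarrow> p (t *\<^sub>R x) \<le> t * p x"
  shows "sublinear p"
  unfolding sublinear_def
proof (intro conjI allI impI)
  fix t :: real and x assume "t \<ge> 0"
  show "p (t *\<^sub>R x) = t * p x"
  proof (cases "t = 0")
    case False
    with \<open>t \<ge> 0\<close> have t: "t > 0" by simp
    have "p ((1 / t) *\<^sub>R (t *\<^sub>R x)) \<le> (1 / t) * p (t *\<^sub>R x)"
      using t by (intro scale) simp
    then have "t * p x \<le> p (t *\<^sub>R x)"
      using t by (simp add: field_simps)
    with scale[OF t, of x] show ?thesis by simp
  qed (use zero in simp)
qed (rule add)

lemma sublinear_add: "sublinear p \<Longrightarrow> p (x + y) \<le> p x + p y"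
  and sublinear_scale: "sublinear p \<Longrightarrow> t \<ge> 0 \<Longrightarrow> p (t *\<^sub>R x) = t * p x"
  by (auto simp: sublinear_def)

lemma sublinear_zero: "sublinear p \<Longrightarrow> p 0 = 0"
  using sublinear_scale[of p 0 0] by simp

lemma sublinear_minus: "sublinear p \<Longrightarrow> - p (- x) \<le> p x"
  using sublinear_add[of p x "- x"] sublinear_zero[of p] by simp

text \<open>Each \<open>q\<close> in the chain satisfies - p (- x) \<le> - q (- x) \<le> q x, so the
  pointwise infimum is finite. Subadditivity survives because two members of the chain can be
  replaced by the smaller one.\<close>

lemma sublinear_Inf_chain:
  fixes p :: "'a::real_vector \<Rightarrow> real"
  assumes "C \<noteq> {}" and sub: "\<And>q. q \<in> C \<Longrightarrow> sublinear q"
    and le: "\<And>q. q \<in> C \<Longrightarrow> q \<le> p"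
    and chain: "\<And>q q'. q \<in> C \<Longrightarrow> q' \<in> C \<Longrightarrow> q \<le> q' \<or> q' \<le> q"
  shows "sublinear (\<lambda>x. INF q\<in>C. q x)" "\<And>q. q \<in> C \<Longrightarrow> (\<lambda>x. INF q\<in>C. q x) \<le> q"
proof -
  have bdd: "bdd_below ((\<lambda>q. q x) ` C)" for x
  proof (rule bdd_belowI2)
    fix q assume "q \<in> C"
    then have "- p (- x) \<le> - q (- x)" using le by (auto simp: le_fun_def)
    also have "\<dots> \<le> q x" using sublinear_minus[OF sub[OF \<open>q \<in> C\<close>]] .
    finally show "- p (- x) \<le> q x" .
  qed
  show *: "(\<lambda>x. INF q\<in>C. q x) \<le> q" if "q \<in> C" for q
    using that bdd by (auto simp: le_fun_def intro: cINF_lower)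
  show "sublinear (\<lambda>x. INF q\<in>C. q x)"
  proof (rule sublinearI)
    fix x y
    have "(INF q\<in>C. q (x + y)) - q' y \<le> q x" if q: "q \<in> C" "q' \<in> C" for q q'
    proof -
      obtain q'' where q'': "q'' \<in> C" "q'' \<le> q" "q'' \<le> q'"
        using chain[OF q] q by auto
      have "(INF q\<in>C. q (x + y)) \<le> q'' (x + y)" using q'' bdd by (intro cINF_lower)
      also have "\<dots> \<le> q'' x + q'' y" using sub q'' by (intro sublinear_add)
      also have "\<dots> \<le> q x + q' y" using q'' by (auto simp: le_fun_def intro: add_mono)
      finally show ?thesis by simp
    qed
    then have "(INF q\<in>C. q (x + y)) - q' y \<le> (INF q\<in>C. q x)" if "q' \<in> C" for q'
      using that \<open>C \<noteq> {}\<close> by (intro cINF_greatest) auto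
    then have "(INF q\<in>C. q (x + y)) - (INF q\<in>C. q x) \<le> q' y" if "q' \<in> C" for q'
      using that by (auto simp: algebra_simps)
    then have "(INF q\<in>C. q (x + y)) - (INF q\<in>C. q x) \<le> (INF q\<in>C. q y)"
      using \<open>C \<noteq> {}\<close> by (intro cINF_greatest) auto
    then show "(INF q\<in>C. q (x + y)) \<le> (INF q\<in>C. q x) + (INF q\<in>C. q y)" by simp
  next
    have "(INF q\<in>C. q 0) = (INF q\<in>C. (0::real))"
      using sub by (intro INF_cong) (auto simp: sublinear_zero)
    then show "(INF q\<in>C. q 0) = 0" using \<open>C \<noteq> {}\<close> by simp
  next
    fix t :: real and x assume t: "t > 0"
    have "(INF q\<in>C. q (t *\<^sub>R x)) / t \<le> q x" if "q \<in> C" for q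
    proof -
      have "(INF q\<in>C. q (t *\<^sub>R x)) \<le> q (t *\<^sub>R x)" using that bdd by (intro cINF_lower)
      also have "\<dots> = t * q x" using sub that t by (intro sublinear_scale) auto
      finally show ?thesis using t by (simp add: field_simps)
    qed
    then have "(INF q\<in>C. q (t *\<^sub>R x)) / t \<le> (INF q\<in>C. q x)"
      using \<open>C \<noteq> {}\<close> by (intro cINF_greatest) auto
    then show "(INF q\<in>C. q (t *\<^sub>R x)) \<le> t * (INF q\<in>C. q x)"
      using t by (simp add: field_simps)
  qed
qed

text \<open>Lower \<open>q\<close> in the direction \<open>y\<close>: the infimum of q (x + t y) - t
  q y over t \<ge> 0 is again sublinear and at most \<open>q\<close>, so by minimality it equals
  \<open>q\<close>. The member t = 1 of the infimum is then the claim.\<close>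

lemma sublinear_minimal_superadditive:
  fixes q :: "'a::real_vector \<Rightarrow> real"
  assumes q: "sublinear q" and min: "\<And>q'. sublinear q' \<Longrightarrow> q' \<le> q \<Longrightarrow> q' = q"
  shows "q x + q y \<le> q (x + y)"
proof -
  define q' where "q' x = (INF t\<in>{0..}. q (x + t *\<^sub>R y) - t * q y)" for x
  have bdd: "bdd_below ((\<lambda>t. q (x + t *\<^sub>R y) - t * q y) ` {0..})" for x
  proof (rule bdd_belowI2)
    fix t :: real assume "t \<in> {0..}"
    then have "t * q y = q ((x + t *\<^sub>R y) + (- x))" using q by (simp add: sublinear_scale)
    also have "\<dots> \<le> q (x + t *\<^sub>R y) + q (- x)" using q by (rule sublinear_add)
    finally show "- q (- x) \<le> q (x + t *\<^sub>R y) - t * q y" by simp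
  qed
  have le: "q' x \<le> q (x + t *\<^sub>R y) - t * q y" if "t \<ge> 0" for x t
    unfolding q'_def using that by (intro cINF_lower bdd) auto
  have ge: "c \<le> q' x" if "\<And>t. t \<ge> 0 \<Longrightarrow> c \<le> q (x + t *\<^sub>R y) - t * q y" for c x
    unfolding q'_def using that by (intro cINF_greatest) auto
  have "sublinear q'"
  proof (rule sublinearI)
    fix u v
    have "q' (u + v) - (q (v + s *\<^sub>R y) - s * q y) \<le> q (u + t *\<^sub>R y) - t * q y"
      if "t \<ge> 0" "s \<ge> 0" for s t
    proof -
      have "q' (u + v) \<le> q ((u + v) + (t + s) *\<^sub>R y) - (t + s) * q y"
        using that by (intro le) auto
      also have "(u + v) + (t + s) *\<^sub>R y = (u + t *\<^sub>R y) + (v + s *\<^sub>R y)"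
        by (simp add: algebra_simps)
      finally show ?thesis
        using sublinear_add[OF q, of "u + t *\<^sub>R y" "v + s *\<^sub>R y"] by (simp add: algebra_simps)
    qed
    then have "q' (u + v) - (q (v + s *\<^sub>R y) - s * q y) \<le> q' u" if "s \<ge> 0" for s
      using that by (intro ge) auto
    then have "q' (u + v) - q' u \<le> q' v"
      by (intro ge) (auto simp: algebra_simps)
    then show "q' (u + v) \<le> q' u + q' v" by simp
  next
    show "q' 0 = 0"
    proof (rule antisym)
      show "q' 0 \<le> 0" using le[of 0 0] q by (simp add: sublinear_zero)
      show "0 \<le> q' 0" by (rule ge) (use q in \<open>simp add: sublinear_scale\<close>)
    qed
  next
    fix t :: real and u assume t: "t > 0"
    have "q' (t *\<^sub>R u) / t \<le> q' u"
    proof (rule ge)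
      fix s :: real assume s: "s \<ge> 0"
      have "q' (t *\<^sub>R u) \<le> q (t *\<^sub>R u + (t * s) *\<^sub>R y) - (t * s) * q y"
        using s t by (intro le) auto
      also have "t *\<^sub>R u + (t * s) *\<^sub>R y = t *\<^sub>R (u + s *\<^sub>R y)"
        by (simp add: algebra_simps)
      also have "q \<dots> = t * q (u + s *\<^sub>R y)" using t q by (intro sublinear_scale) auto
      finally show "q' (t *\<^sub>R u) / t \<le> q (u + s *\<^sub>R y) - s * q y"
        using t by (simp add: field_simps)
    qed
    then show "q' (t *\<^sub>R u) \<le> t * q' u" using t by (simp add: field_simps)
  qed
  moreover have "q' \<le> q" using le[of 0] by (auto simp: le_fun_def)
  ultimately have "q' = q" by (rule min)
  with le[of 1 x] show ?thesis by simp
qed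

text \<open>A minimal sublinear functional is linear, and Zorn's lemma provides one below \<open>p\<close>.\<close>

theorem sublinear_dominates_linear:
  fixes p :: "'a::real_vector \<Rightarrow> real"
  assumes p: "sublinear p"
  obtains u where "linear u" "u \<le> p"
proof -
  let ?P = "\<lambda>q. sublinear q \<and> q \<le> p"
  \<comment> \<open>The order is reversed, so that a maximal element in Zorn's lemma is a minimal
    sublinear functional.\<close>
  define R where "R = {(q, q'). ?P q \<and> ?P q' \<and> q' \<le> q}"
  have Field: "Field R = {q. ?P q}" by (auto simp: R_def Field_def)
  have "Partial_order R"
    by (auto simp: Field partial_order_on_def preorder_on_def refl_on_def trans_def antisym_def)
       (auto simp: R_def)
  then have "\<exists>m\<in>Field R. \<forall>q\<in>Field R. (m, q) \<in> R \<longrightarrow> q = m"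
  proof (rule Zorns_po_lemma)
    fix C assume C: "C \<in> Chains R"
    then have CP: "?P q" if "q \<in> C" for q using that by (auto simp: Chains_def R_def)
    show "\<exists>u\<in>Field R. \<forall>q\<in>C. (q, u) \<in> R"
    proof (cases "C = {}")
      case True
      then show ?thesis using p by (auto simp: Field)
    next
      case False
      have chain: "q \<le> q' \<or> q' \<le> q" if "q \<in> C" "q' \<in> C" for q q'
        using C that by (auto simp: Chains_def R_def)
      have S: "sublinear (\<lambda>x. INF q\<in>C. q x)" "\<And>q. q \<in> C \<Longrightarrow> (\<lambda>x. INF q\<in>C. q x) \<le> q"
        using sublinear_Inf_chain[OF False _ _ chain, of p] CP by auto
      from False obtain q0 where "q0 \<in> C" by auto
      then have "(\<lambda>x. INF q\<in>C. q x) \<le> p" using S(2)[of q0] CP[of q0] by (blast intro: order_trans)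
      with S CP show ?thesis
        unfolding Field by (intro bexI[of _ "\<lambda>x. INF q\<in>C. q x"]) (auto simp: R_def)
    qed
  qed
  then obtain q where q: "sublinear q" "q \<le> p" and "\<And>q'. ?P q' \<Longrightarrow> (q, q') \<in> R \<Longrightarrow> q' = q"
    unfolding Field by blast
  then have min: "\<And>q'. sublinear q' \<Longrightarrow> q' \<le> q \<Longrightarrow> q' = q"
    by (auto simp: R_def intro: order_trans)
  have add: "q (x + y) = q x + q y" for x y
    using sublinear_add[OF q(1)] sublinear_minimal_superadditive[OF q(1) min] by (intro antisym)
  have minus: "q (- x) = - q x" for x
    using add[of x "- x"] sublinear_zero[OF q(1)] by simp
  have "linear q"
  proof (rule linearI)
    show "q (t *\<^sub>R x) = t *\<^sub>R q x" for t x
    proof (cases "t \<ge> 0")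
      case False
      then have "q ((- t) *\<^sub>R x) = (- t) * q x" using q(1) by (intro sublinear_scale) auto
      then show ?thesis by (simp add: minus)
    qed (use sublinear_scale[OF q(1)] in simp)
  qed (rule add)
  with q(2) show ?thesis by (rule that[rotated])
qed

text \<open>
  The functional to be extended is given by its graph \<open>G\<close>, so that no well-definedness has to be
  checked first: the bound implies that \<open>G\<close> is the graph of a function.
\<close>

theorem Hahn_Banach_linear_relation:
  fixes G :: "('a::real_normed_vector \<times> real) set"
  assumes G: "subspace G" and C: "C \<ge> 0" and bound: "\<And>s v. (s, v) \<in> G \<Longrightarrow> v \<le> C * norm s"
  obtains u where "linear u" "\<And>x. \<bar>u x\<bar> \<le> C * norm x" "\<And>s v. (s, v) \<in> G \<Longrightarrow> u s = v"
proof -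
  \<comment> \<open>The infimal convolution of the graph with C times the norm. Since
    \<open>G\<close> contains (0, 0), \<open>p\<close> is at most C times the norm; choosing s = x
    shows that it is at most \<open>v\<close> at \<open>s\<close>. A linear map below
    \<open>p\<close> therefore has the bound and, using both signs, extends the graph.\<close>
  define p where "p x = (INF (s, v)\<in>G. v + C * norm (x - s))" for x
  have Gadd: "(s + s', v + v') \<in> G" if "(s, v) \<in> G" "(s', v') \<in> G" for s v s' v'
    using subspace_add[OF G that] by simp
  have Gscale: "(t *\<^sub>R s, t * v) \<in> G" if "(s, v) \<in> G" for s v t
    using subspace_scale[OF G that, of t] by simp
  have G0: "(0, 0) \<in> G" using subspace_0[OF G] by (simp add: zero_prod_def)
  have lower: "- (C * norm x) \<le> v + C * norm (x - s)" if "(s, v) \<in> G" for s v x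
  proof -
    have "- v \<le> C * norm s" using bound[OF Gscale[OF that, of "-1"]] by simp
    also have "\<dots> \<le> C * (norm (x - s) + norm x)"
      using C norm_triangle_ineq4[of x "x - s"] by (intro mult_left_mono) auto
    finally show ?thesis by (simp add: algebra_simps)
  qed
  have bdd: "bdd_below ((\<lambda>(s, v). v + C * norm (x - s)) ` G)" for x
    by (rule bdd_belowI2[where m = "- (C * norm x)"]) (use lower in auto)
  have le: "p x \<le> v + C * norm (x - s)" if "(s, v) \<in> G" for x s v
    unfolding p_def using cINF_lower[OF bdd that] by auto
  have ge: "c \<le> p x" if "\<And>s v. (s, v) \<in> G \<Longrightarrow> c \<le> v + C * norm (x - s)" for c x
    unfolding p_def using that G0 by (intro cINF_greatest) auto
  have "sublinear p"
  proof (rule sublinearI)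
    fix x y
    have "p (x + y) - (v' + C * norm (y - s')) \<le> v + C * norm (x - s)"
      if "(s, v) \<in> G" "(s', v') \<in> G" for s v s' v'
    proof -
      have "p (x + y) \<le> (v + v') + C * norm ((x + y) - (s + s'))"
        using that by (intro le Gadd)
      also have "(x + y) - (s + s') = (x - s) + (y - s')" by simp
      also have "C * norm \<dots> \<le> C * (norm (x - s) + norm (y - s'))"
        using C by (intro mult_left_mono norm_triangle_ineq)
      finally show ?thesis by (simp add: algebra_simps)
    qed
    then have "p (x + y) - (v' + C * norm (y - s')) \<le> p x" if "(s', v') \<in> G" for s' v'
      using that by (intro ge) auto
    then have "p (x + y) - p x \<le> p y"
      by (intro ge) (auto simp: algebra_simps)
    then show "p (x + y) \<le> p x + p y" by simp
  next
    show "p 0 = 0"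
      using le[OF G0, of 0] ge[of 0 0] lower[of _ _ 0] by (intro antisym) auto
  next
    fix t :: real and x assume t: "t > 0"
    have "p (t *\<^sub>R x) / t \<le> p x"
    proof (rule ge)
      fix s v assume "(s, v) \<in> G"
      then have "p (t *\<^sub>R x) \<le> t * v + C * norm (t *\<^sub>R x - t *\<^sub>R s)"
        by (intro le Gscale)
      also have "norm (t *\<^sub>R x - t *\<^sub>R s) = t * norm (x - s)"
        using t by (simp flip: scaleR_diff_right)
      finally show "p (t *\<^sub>R x) / t \<le> v + C * norm (x - s)"
        using t by (simp add: field_simps)
    qed
    then show "p (t *\<^sub>R x) \<le> t * p x" using t by (simp add: field_simps)
  qed
  then obtain u where u: "linear u" "u \<le> p" by (rule sublinear_dominates_linear)
  have up: "u x \<le> p x" for x using u(2) by (auto simp: le_fun_def)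
  have neg: "u (- x) = - u x" for x using u(1) by (rule linear_neg)
  have "u x \<le> C * norm x" for x
    using up[of x] le[OF G0, of x] by simp
  from this this[of "- x" for x] have "\<bar>u x\<bar> \<le> C * norm x" for x
    by (simp add: neg abs_le_iff)
  moreover have "u s = v" if "(s, v) \<in> G" for s v
  proof (rule antisym)
    show "u s \<le> v" using up[of s] le[OF that, of s] by simp
    show "v \<le> u s"
      using up[of "- s"] le[OF Gscale[OF that, of "-1"], of "- s"] by (simp add: neg)
  qed
  ultimately show ?thesis using u(1) that by blast
qed


section \<open>Ultrafilter limits\<close>

text \<open>The class axiom does not state that the embedding is unital. But \<phi> 1 is idempotent
  and of norm 1, hence a nonzero idempotent in the complex field, so it is 1, and real scalars are
  preserved.\<close>

lemma real_or_complex_embedding: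
  "\<exists>\<phi> :: 'k::real_or_complex \<Rightarrow> complex. linear \<phi> \<and> (\<forall>x y. \<phi> (x * y) = \<phi> x * \<phi> y) \<and>
     (\<forall>x. norm (\<phi> x) = norm x) \<and> (\<forall>r. \<phi> (of_real r) = of_real r) \<and>
     (range \<phi> = \<real> \<or> range \<phi> = UNIV)"
proof -
  obtain \<phi> :: "'k \<Rightarrow> complex" where \<phi>: "\<And>x y. \<phi> (x + y) = \<phi> x + \<phi> y" "\<And>x y. \<phi> (x * y) = \<phi> x * \<phi> y"
    "\<And>r x. \<phi> (r *\<^sub>R x) = r *\<^sub>R \<phi> x" "\<And>x. norm (\<phi> x) = norm x" "range \<phi> = \<real> \<or> range \<phi> = UNIV"
    using real_or_complex by metis
  have "\<phi> 1 * \<phi> 1 = \<phi> 1" using \<phi>(2)[of 1 1] by simp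
  moreover have "\<phi> 1 \<noteq> 0" using \<phi>(4)[of 1] by auto
  ultimately have "\<phi> 1 = 1" by simp
  then have "\<phi> (of_real r) = of_real r" for r
    by (simp add: of_real_def \<phi>(3))
  moreover have "linear \<phi>" using \<phi> by (intro linearI) auto
  ultimately show ?thesis using \<phi> by blast
qed

text \<open>The embedding is an isometry onto a closed subset of the complex plane, so the ball is
  the continuous image, under the inverse, of a closed piece of a compact disc.\<close>

lemma compact_cball_real_or_complex: "compact (cball (0::'k::real_or_complex) R)"
proof -
  obtain \<phi> :: "'k \<Rightarrow> complex" where \<phi>: "linear \<phi>" "\<And>x. norm (\<phi> x) = norm x"
    "range \<phi> = \<real> \<or> range \<phi> = UNIV"
    using real_or_complex_embedding by blast
  have dist: "dist (\<phi> x) (\<phi> y) = dist x y" for x y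
    by (simp add: dist_norm \<phi>(2) flip: linear_diff[OF \<phi>(1)])
  then have inj: "inj \<phi>" by (metis dist_eq_0_iff injI)
  have "closed (range \<phi>)" using \<phi>(3) closed_complex_Reals by auto
  then have "compact (cball 0 R \<inter> range \<phi>)" by (intro compact_Int_closed) auto
  moreover have "continuous_on (cball 0 R \<inter> range \<phi>) (inv \<phi>)"
    unfolding continuous_on_iff by (auto simp: inv_f_f[OF inj] dist)
  ultimately have "compact (inv \<phi> ` (cball 0 R \<inter> range \<phi>))"
    by (rule compact_continuous_image[rotated])
  also have "inv \<phi> ` (cball 0 R \<inter> range \<phi>) = cball 0 R"
  proof (intro equalityI subsetI)
    fix x :: 'k assume "x \<in> cball 0 R"
    then show "x \<in> inv \<phi> ` (cball 0 R \<inter> range \<phi>)"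
      using inv_f_f[OF inj, of x] by (intro image_eqI[of _ _ "\<phi> x"]) (auto simp: \<phi>(2))
  qed (auto simp: inv_f_f[OF inj] \<phi>(2))
  finally show ?thesis .
qed

section \<open>Existence of ultrafilters and convergence along them\<close>

definition ultrafilter :: "'a filter \<Rightarrow> bool" where
  "ultrafilter U \<longleftrightarrow> U \<noteq> bot \<and> (\<forall>P. eventually P U \<or> eventually (\<lambda>x. \<not> P x) U)"

lemma ultrafilter_not_bot: "ultrafilter U \<Longrightarrow> U \<noteq> bot"
  by (simp add: ultrafilter_def)

lemma ultrafilter_not_eventually:
  "ultrafilter U \<Longrightarrow> \<not> eventually P U \<Longrightarrow> eventually (\<lambda>x. \<not> P x) U"
  by (auto simp: ultrafilter_def)

text \<open>An ultrafilter is a minimal proper filter. The infimum of a nonempty chain of proper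
  filters is proper, since whatever holds eventually for it does so for some member. If the negation
  of \<open>P\<close> is not eventually true in a minimal \<open>U\<close>, restricting
  \<open>U\<close> to \<open>P\<close> leaves a proper filter, which must be \<open>U\<close>
  itself.\<close>

theorem exists_ultrafilter_le:
  assumes "F \<noteq> bot"
  obtains U where "ultrafilter U" "U \<le> F"
proof -
  let ?P = "\<lambda>G. G \<noteq> bot \<and> G \<le> F"
  define R where "R = {(G, H). ?P G \<and> ?P H \<and> H \<le> G}"
  have Field: "Field R = {G. ?P G}" by (auto simp: R_def Field_def)
  have "Partial_order R"
    by (auto simp: Field partial_order_on_def preorder_on_def refl_on_def trans_def antisym_def)
       (auto simp: R_def)
  then have "\<exists>M\<in>Field R. \<forall>G\<in>Field R. (M, G) \<in> R \<longrightarrow> G = M"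
  proof (rule Zorns_po_lemma)
    fix C assume C: "C \<in> Chains R"
    then have CP: "?P G" if "G \<in> C" for G using that by (auto simp: Chains_def R_def)
    show "\<exists>U\<in>Field R. \<forall>G\<in>C. (G, U) \<in> R"
    proof (cases "C = {}")
      case True
      then show ?thesis using assms by (auto simp: Field)
    next
      case False
      have "\<exists>x\<in>C. x \<le> inf G H" if "G \<in> C" "H \<in> C" for G H
        using C that by (auto simp: Chains_def R_def)
      then have "Inf C \<noteq> bot"
        using False CP by (auto simp: trivial_limit_def eventually_Inf_base)
      moreover have "Inf C \<le> F" using False CP by (metis Inf_lower2 ex_in_conv)
      ultimately show ?thesis
        using CP unfolding Field by (intro bexI[of _ "Inf C"]) (auto simp: R_def Inf_lower)
    qed
  qed
  then obtain U where U: "U \<noteq> bot" "U \<le> F" and "\<And>G. ?P G \<Longrightarrow> (U, G) \<in> R \<Longrightarrow> G = U"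
    unfolding Field by blast
  then have min: "\<And>G. G \<noteq> bot \<Longrightarrow> G \<le> U \<Longrightarrow> G = U"
    by (auto simp: R_def intro: order_trans)
  have "eventually P U" if "\<not> eventually (\<lambda>x. \<not> P x) U" for P
  proof -
    have "inf U (principal {x. P x}) \<noteq> bot"
      using that by (simp add: trivial_limit_def eventually_inf_principal)
    then have "inf U (principal {x. P x}) = U" by (intro min) auto
    then have "U \<le> principal {x. P x}" by (metis inf.cobounded2)
    then show ?thesis by (simp add: le_principal)
  qed
  then have "ultrafilter U" using U by (auto simp: ultrafilter_def)
  with U(2) show ?thesis using that by blast
qed

text \<open>Compactness gives a cluster point of the image filter. For an ultrafilter a cluster
  point is a limit: a neighbourhood not eventually entered would be eventually avoided.\<close>

lemma ultrafilter_tendsto: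
  assumes U: "ultrafilter U" and K: "compact K" "\<forall>\<^sub>F x in U. f x \<in> K"
  obtains l where "l \<in> K" "(f \<longlongrightarrow> l) U"
proof -
  have "filtermap f U \<noteq> bot" using U by (simp add: ultrafilter_def filtermap_bot_iff)
  then obtain l where l: "l \<in> K" "inf (nhds l) (filtermap f U) \<noteq> bot"
    using K by (auto simp: compact_filter eventually_filtermap)
  have "(f \<longlongrightarrow> l) U"
  proof (rule topological_tendstoI)
    fix S assume S: "open S" "l \<in> S"
    show "\<forall>\<^sub>F x in U. f x \<in> S"
    proof (rule ccontr)
      assume "\<not> (\<forall>\<^sub>F x in U. f x \<in> S)"
      then have "eventually (\<lambda>y. y \<notin> S) (filtermap f U)"
        using ultrafilter_not_eventually[OF U] by (simp add: eventually_filtermap)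
      moreover have "eventually (\<lambda>y. y \<in> S) (nhds l)" using S by (rule eventually_nhds_in_open)
      ultimately have "eventually (\<lambda>y. False) (inf (nhds l) (filtermap f U))"
        unfolding eventually_inf by blast
      with l(2) show False by (simp add: trivial_limit_def)
    qed
  qed
  with l(1) show ?thesis by (rule that)
qed

definition ulim :: "'i filter \<Rightarrow> ('i \<Rightarrow> 'k::real_or_complex) \<Rightarrow> 'k" where
  "ulim U f = Lim U f"

lemma ulim_eq: "ultrafilter U \<Longrightarrow> (f \<longlongrightarrow> l) U \<Longrightarrow> ulim U f = l"
  unfolding ulim_def by (rule tendsto_Lim) (auto simp: ultrafilter_not_bot)

lemma ulim_const: "ultrafilter U \<Longrightarrow> ulim U (\<lambda>x. c) = c"
  by (rule ulim_eq) auto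

text \<open>Closed balls of scalars are compact, so eventual boundedness is all that is needed for
  \<open>ulim\<close> to be a true limit rather than an arbitrary value.\<close>

lemma
  fixes f :: "'i \<Rightarrow> 'k::real_or_complex"
  assumes U: "ultrafilter U" and f: "\<forall>\<^sub>F i in U. norm (f i) \<le> C"
  shows tendsto_ulim: "(f \<longlongrightarrow> ulim U f) U" and norm_ulim_le: "norm (ulim U f) \<le> C"
proof -
  obtain l where l: "l \<in> cball 0 C" "(f \<longlongrightarrow> l) U"
    using ultrafilter_tendsto[OF U compact_cball_real_or_complex[of C], of f] f by auto
  with ulim_eq[OF U l(2)] show "(f \<longlongrightarrow> ulim U f) U" "norm (ulim U f) \<le> C" by auto
qed

lemma
  fixes f g :: "'i \<Rightarrow> 'k::real_or_complex"
  assumes U: "ultrafilter U" and f: "\<forall>\<^sub>F i in U. norm (f i) \<le> C"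
  shows ulim_mult: "ulim U (\<lambda>i. c * f i) = c * ulim U f"
    and ulim_add: "\<forall>\<^sub>F i in U. norm (g i) \<le> C' \<Longrightarrow> ulim U (\<lambda>i. f i + g i) = ulim U f + ulim U g"
  using tendsto_ulim[OF U f] tendsto_ulim[OF U, of g C']
  by (auto intro!: ulim_eq[OF U] tendsto_intros)

lemma ulim_cong:
  assumes "\<forall>\<^sub>F i in U. f i = g i"
  shows "ulim U f = ulim U g"
  unfolding ulim_def t2_space_class.Lim_def using filterlim_cong[OF refl refl assms] by simp

definition ulim2 :: "'i filter \<Rightarrow> 'j filter \<Rightarrow> ('i \<Rightarrow> 'j \<Rightarrow> 'k::real_or_complex) \<Rightarrow> 'k" where
  "ulim2 U V F = ulim U (\<lambda>i. ulim V (F i))"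

lemma
  fixes F G :: "'i \<Rightarrow> 'j \<Rightarrow> 'k::real_or_complex"
  assumes U: "ultrafilter U" and V: "ultrafilter V"
    and F: "\<forall>\<^sub>F i in U. \<forall>\<^sub>F j in V. norm (F i j) \<le> C"
  shows norm_ulim2_le: "norm (ulim2 U V F) \<le> C"
    and ulim2_mult: "ulim2 U V (\<lambda>i j. c * F i j) = c * ulim2 U V F"
    and ulim2_add: "\<forall>\<^sub>F i in U. \<forall>\<^sub>F j in V. norm (G i j) \<le> C' \<Longrightarrow>
      ulim2 U V (\<lambda>i j. F i j + G i j) = ulim2 U V F + ulim2 U V G"
proof -
  have F': "\<forall>\<^sub>F i in U. norm (ulim V (F i)) \<le> C"
    using F by eventually_elim (rule norm_ulim_le[OF V])
  show "norm (ulim2 U V F) \<le> C"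
    unfolding ulim2_def by (rule norm_ulim_le[OF U F'])
  have "\<forall>\<^sub>F i in U. ulim V (\<lambda>j. c * F i j) = c * ulim V (F i)"
    using F by eventually_elim (rule ulim_mult[OF V])
  then have "ulim2 U V (\<lambda>i j. c * F i j) = ulim U (\<lambda>i. c * ulim V (F i))"
    unfolding ulim2_def by (rule ulim_cong)
  also have "\<dots> = c * ulim2 U V F"
    unfolding ulim2_def by (rule ulim_mult[OF U F'])
  finally show "ulim2 U V (\<lambda>i j. c * F i j) = c * ulim2 U V F" .
  assume G: "\<forall>\<^sub>F i in U. \<forall>\<^sub>F j in V. norm (G i j) \<le> C'"
  have G': "\<forall>\<^sub>F i in U. norm (ulim V (G i)) \<le> C'"
    using G by eventually_elim (rule norm_ulim_le[OF V])
  have "\<forall>\<^sub>F i in U. ulim V (\<lambda>j. F i j + G i j) = ulim V (F i) + ulim V (G i)"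
    using F G by eventually_elim (rule ulim_add[OF V])
  then have "ulim2 U V (\<lambda>i j. F i j + G i j) = ulim U (\<lambda>i. ulim V (F i) + ulim V (G i))"
    unfolding ulim2_def by (rule ulim_cong)
  also have "\<dots> = ulim2 U V F + ulim2 U V G"
    unfolding ulim2_def by (rule ulim_add[OF U F' G'])
  finally show "ulim2 U V (\<lambda>i j. F i j + G i j) = ulim2 U V F + ulim2 U V G" .
qed

lemma ulim2_eq:
  assumes U: "ultrafilter U" and V: "ultrafilter V"
    and "\<forall>\<^sub>F i in U. (F i \<longlongrightarrow> l) V"
  shows "ulim2 U V F = l"
proof -
  have "\<forall>\<^sub>F i in U. ulim V (F i) = l"
    using assms(3) by eventually_elim (rule ulim_eq[OF V])
  then have "ulim2 U V F = ulim U (\<lambda>i. l)"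
    unfolding ulim2_def by (rule ulim_cong)
  then show ?thesis by (simp add: ulim_const[OF U])
qed


section \<open>Disjoint cofinal subsets of directed sets\<close>

lemma
  assumes "directed_set \<Lambda> r" "cofinal_subset \<Lambda> r \<Lambda>'"
  shows cofinal_refl: "\<alpha> \<in> \<Lambda>' \<Longrightarrow> (\<alpha>, \<alpha>) \<in> r"
    and cofinal_trans: "(\<alpha>, \<beta>) \<in> r \<Longrightarrow> (\<beta>, \<gamma>) \<in> r \<Longrightarrow> (\<alpha>, \<gamma>) \<in> r"
    and cofinal_not_empty: "\<Lambda>' \<noteq> {}"
    and cofinal_upper_bound: "\<alpha> \<in> \<Lambda>' \<Longrightarrow> \<beta> \<in> \<Lambda>' \<Longrightarrow> \<exists>\<gamma>\<in>\<Lambda>'. (\<alpha>, \<gamma>) \<in> r \<and> (\<beta>, \<gamma>) \<in> r"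
proof -
  have refl: "refl_on \<Lambda> r" and tr: "trans r" and sub: "\<Lambda>' \<subseteq> \<Lambda>" and ne: "\<Lambda> \<noteq> {}"
    and cof: "\<And>\<alpha>. \<alpha> \<in> \<Lambda> \<Longrightarrow> \<exists>\<beta>\<in>\<Lambda>'. (\<alpha>, \<beta>) \<in> r"
    and dir: "\<And>\<alpha> \<beta>. \<alpha> \<in> \<Lambda> \<Longrightarrow> \<beta> \<in> \<Lambda> \<Longrightarrow> \<exists>\<gamma>\<in>\<Lambda>. (\<alpha>, \<gamma>) \<in> r \<and> (\<beta>, \<gamma>) \<in> r"
    using assms by (auto simp: directed_set_def preorder_on_def cofinal_subset_def)
  show "\<alpha> \<in> \<Lambda>' \<Longrightarrow> (\<alpha>, \<alpha>) \<in> r" using refl sub by (auto simp: refl_on_def)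
  show trans: "(\<alpha>, \<beta>) \<in> r \<Longrightarrow> (\<beta>, \<gamma>) \<in> r \<Longrightarrow> (\<alpha>, \<gamma>) \<in> r" for \<alpha> \<beta> \<gamma>
    using tr by (rule transD)
  show "\<Lambda>' \<noteq> {}" using ne cof by auto
  assume "\<alpha> \<in> \<Lambda>'" "\<beta> \<in> \<Lambda>'"
  then obtain \<gamma> where "\<gamma> \<in> \<Lambda>" "(\<alpha>, \<gamma>) \<in> r" "(\<beta>, \<gamma>) \<in> r" using sub dir by blast
  then show "\<exists>\<gamma>\<in>\<Lambda>'. (\<alpha>, \<gamma>) \<in> r \<and> (\<beta>, \<gamma>) \<in> r"
    using cof by (meson trans)
qed

lemma eventually_tails_filter:
  assumes "directed_set \<Lambda> r" "cofinal_subset \<Lambda> r \<Lambda>'"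
  shows "eventually P (tails_filter \<Lambda>' r) \<longleftrightarrow> (\<exists>\<xi>\<in>\<Lambda>'. \<forall>\<alpha>\<in>\<Lambda>'. (\<xi>, \<alpha>) \<in> r \<longrightarrow> P \<alpha>)"
  unfolding tails_filter_def
proof (subst eventually_INF_base)
  show "\<Lambda>' \<noteq> {}" by (rule cofinal_not_empty[OF assms])
  show "\<exists>\<gamma>\<in>\<Lambda>'. principal {\<delta> \<in> \<Lambda>'. (\<gamma>, \<delta>) \<in> r}
      \<le> inf (principal {\<delta> \<in> \<Lambda>'. (\<alpha>, \<delta>) \<in> r}) (principal {\<delta> \<in> \<Lambda>'. (\<beta>, \<delta>) \<in> r})"
    if "\<alpha> \<in> \<Lambda>'" "\<beta> \<in> \<Lambda>'" for \<alpha> \<beta>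
    using cofinal_upper_bound[OF assms that] by (auto intro: cofinal_trans[OF assms])
qed (auto simp: eventually_principal)

text \<open>Since \<open>P\<close> meets every tail, the tails filter restricted to \<open>P\<close>
  is proper and has an ultrafilter below it.\<close>

lemma ultrafilter_on_cofinal_set:
  assumes "directed_set \<Lambda> r" "cofinal_subset \<Lambda> r \<Lambda>'"
    and "\<And>\<xi>. \<xi> \<in> \<Lambda>' \<Longrightarrow> \<exists>\<alpha>\<in>P. \<alpha> \<in> \<Lambda>' \<and> (\<xi>, \<alpha>) \<in> r"
  obtains U where "ultrafilter U" "U \<le> tails_filter \<Lambda>' r" "\<forall>\<^sub>F \<alpha> in U. \<alpha> \<in> P"
proof -
  have "inf (tails_filter \<Lambda>' r) (principal P) \<noteq> bot"
    using assms(3) unfolding trivial_limit_def eventually_inf_principal eventually_tails_filter[OF assms(1,2)]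
    by blast
  then obtain U where U: "ultrafilter U" "U \<le> inf (tails_filter \<Lambda>' r) (principal P)"
    by (rule exists_ultrafilter_le)
  then show ?thesis using that by (simp add: le_principal)
qed

text \<open>Transfinite recursion along the cardinal order of \<open>I\<close>: before stage
  \<open>j\<close> fewer than |I| values have been used, so \<open>S j\<close> is not exhausted and
  a new value can be chosen.\<close>

theorem injective_choice:
  fixes I :: "'j set" and S :: "'j \<Rightarrow> 'b set"
  assumes "\<And>j. j \<in> I \<Longrightarrow> |I| \<le>o |S j|"
  obtains f where "inj_on f I" "\<And>j. j \<in> I \<Longrightarrow> f j \<in> S j"
proof -
  let ?w = "|I|"
  have wo: "Well_order ?w" by (rule card_of_Well_order)
  then have wf: "wf (?w - Id)" and total: "Total ?w"
    by (auto simp: well_order_on_def linear_order_on_def)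
  define f where "f = wfrec (?w - Id) (\<lambda>f j. SOME s. s \<in> S j - f ` underS ?w j)"
  have f: "f j = (SOME s. s \<in> S j - f ` underS ?w j)" for j
  proof -
    have "cut f (?w - Id) j ` underS ?w j = f ` underS ?w j"
      by (intro image_cong) (auto simp: cut_apply underS_def)
    with def_wfrec[OF f_def[THEN eq_reflection] wf, of j] show ?thesis by simp
  qed
  have in_S: "f j \<in> S j - f ` underS ?w j" if "j \<in> I" for j
  proof -
    have "|f ` underS ?w j| \<le>o |underS ?w j|" by (rule card_of_image)
    also have "|underS ?w j| <o ?w"
      using that by (intro card_of_underS card_of_Card_order) (simp add: Field_card_of)
    also have "?w \<le>o |S j|" using that by (rule assms)
    finally have "\<not> S j \<subseteq> f ` underS ?w j"
      using card_of_mono1 not_ordLess_ordLeq by blast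
    then have "\<exists>s. s \<in> S j - f ` underS ?w j" by auto
    then show ?thesis unfolding f[of j] by (rule someI_ex)
  qed
  have "inj_on f I"
  proof (rule inj_onI, rule ccontr)
    fix j k assume jk: "j \<in> I" "k \<in> I" "f j = f k" "j \<noteq> k"
    then have "j \<in> underS ?w k \<or> k \<in> underS ?w j"
      using total by (auto simp: total_on_def underS_def Field_card_of)
    then show False using in_S[OF jk(1)] in_S[OF jk(2)] jk(3) by (metis DiffD2 imageI)
  qed
  with in_S show ?thesis using that by blast
qed

text \<open>Some tail has at most \<eta> elements and every strict upper set has at least \<eta>.
  Hence one can choose, for all \<alpha> in that tail and all \<open>i\<close>, distinct elements f
  (\<alpha>, i) strictly above \<alpha>. For fixed \<open>i\<close> they form a cofinal piece, and
  injectivity of \<open>f\<close> makes the pieces disjoint.\<close>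

theorem disjoint_cofinal_family:
  fixes \<eta> :: "'c rel"
  assumes "Cinfinite \<eta>" and dir: "directed_set \<Lambda> r" "cofinal_subset \<Lambda> r \<Lambda>'"
    and tr: "true_cardinality \<Lambda>' r =o \<eta>"
  obtains P where "\<And>i. i \<in> Field \<eta> \<Longrightarrow> P i \<subseteq> \<Lambda>'"
    "\<And>i \<xi>. i \<in> Field \<eta> \<Longrightarrow> \<xi> \<in> \<Lambda>' \<Longrightarrow> \<exists>\<alpha>\<in>P i. (\<xi>, \<alpha>) \<in> r"
    "\<And>i j. i \<in> Field \<eta> \<Longrightarrow> j \<in> Field \<eta> \<Longrightarrow> i \<noteq> j \<Longrightarrow> P i \<inter> P j = {}"
proof -
  have inf: "\<not> finite (Field \<eta>)" and card: "Card_order \<eta>"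
    using assms(1) by (auto simp: cinfinite_def)
  have "strictly_above \<Lambda>' r ` \<Lambda>' \<noteq> {}"
    using cofinal_not_empty[OF dir] by auto
  then obtain \<xi>0 where \<xi>0: "\<xi>0 \<in> \<Lambda>'" "true_cardinality \<Lambda>' r = |strictly_above \<Lambda>' r \<xi>0|"
    and min: "\<And>\<xi>. \<xi> \<in> \<Lambda>' \<Longrightarrow> |strictly_above \<Lambda>' r \<xi>0| \<le>o |strictly_above \<Lambda>' r \<xi>|"
    unfolding true_cardinality_def by (rule min_card_attained) auto
  have above: "\<eta> \<le>o |strictly_above \<Lambda>' r \<xi>|" if "\<xi> \<in> \<Lambda>'" for \<xi>
    using min[OF that] tr \<xi>0(2) by (metis ordIso_ordLeq_trans ordIso_symmetric)
  \<comment> \<open>The choice is made over this tail only, because \<open>\<Lambda>'\<close> itself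
    may have more than \<eta> elements. A tail is enough: every element of \<open>\<Lambda>'\<close>
    has something of \<open>?I\<close> above it.\<close>
  let ?I = "{\<alpha>\<in>\<Lambda>'. (\<xi>0, \<alpha>) \<in> r}"
  have "|strictly_above \<Lambda>' r \<xi>0| \<le>o \<eta>" using tr \<xi>0(2) by (simp add: ordIso_imp_ordLeq)
  moreover have "|{\<xi>0}| \<le>o \<eta>"
    using inf card by (intro ordLess_imp_ordLeq finite_ordLess_infinite) (auto simp: card_order_on_def card_of_well_order_on Field_card_of)
  ultimately have "|{\<xi>0} \<union> strictly_above \<Lambda>' r \<xi>0| \<le>o \<eta>"
    using inf card by (intro card_of_Un_ordLeq_infinite_Field)
  moreover have "?I \<subseteq> {\<xi>0} \<union> strictly_above \<Lambda>' r \<xi>0" by (auto simp: strictly_above_def)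
  ultimately have "|?I| \<le>o \<eta>" using card_of_mono1 ordLeq_transitive by blast
  then have "|?I \<times> Field \<eta>| \<le>o \<eta>"
    using inf card by (intro card_of_Times_ordLeq_infinite_Field)
      (auto intro: ordIso_imp_ordLeq card_of_Field_ordIso)
  then have "|?I \<times> Field \<eta>| \<le>o |strictly_above \<Lambda>' r (fst j)|" if "j \<in> ?I \<times> Field \<eta>" for j
    using above[of "fst j"] that ordLeq_transitive by auto
  then obtain f where f: "inj_on f (?I \<times> Field \<eta>)"
    "\<And>j. j \<in> ?I \<times> Field \<eta> \<Longrightarrow> f j \<in> strictly_above \<Lambda>' r (fst j)"
    using injective_choice[of "?I \<times> Field \<eta>" "\<lambda>j. strictly_above \<Lambda>' r (fst j)"] by blast
  show ?thesis
  proof (rule that[of "\<lambda>i. (\<lambda>\<alpha>. f (\<alpha>, i)) ` ?I"])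
    show "(\<lambda>\<alpha>. f (\<alpha>, i)) ` ?I \<subseteq> \<Lambda>'" if "i \<in> Field \<eta>" for i
      using f(2) that by (fastforce simp: strictly_above_def)
    show "(\<lambda>\<alpha>. f (\<alpha>, i)) ` ?I \<inter> (\<lambda>\<alpha>. f (\<alpha>, j)) ` ?I = {}"
      if "i \<in> Field \<eta>" "j \<in> Field \<eta>" "i \<noteq> j" for i j
      using f(1) that by (auto simp: inj_on_def)
    show "\<exists>\<alpha>\<in>(\<lambda>\<alpha>. f (\<alpha>, i)) ` ?I. (\<xi>, \<alpha>) \<in> r" if i: "i \<in> Field \<eta>" and "\<xi> \<in> \<Lambda>'" for i \<xi>
    proof -
      obtain \<gamma> where \<gamma>: "\<gamma> \<in> ?I" "(\<xi>, \<gamma>) \<in> r"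
        using cofinal_upper_bound[OF dir \<xi>0(1) \<open>\<xi> \<in> \<Lambda>'\<close>] by auto
      with f(2)[of "(\<gamma>, i)"] i have "(\<gamma>, f (\<gamma>, i)) \<in> r" by (auto simp: strictly_above_def)
      with \<gamma> show ?thesis using cofinal_trans[OF dir] by blast
    qed
  qed
qed


section \<open>The dual of a Banach algebra\<close>

lemma mem_linfty:
  "f \<in> vcarrier (linfty \<eta>) \<longleftrightarrow> (\<exists>C. \<forall>i\<in>Field \<eta>. norm (f i) \<le> C) \<and> (\<forall>i. i \<notin> Field \<eta> \<longrightarrow> f i = 0)"
  by (auto simp: linfty_def bounded_iff)

lemma norm_le_linfty_norm:
  assumes "f \<in> vcarrier (linfty \<eta>)" "i \<in> Field \<eta>"
  shows "norm (f i) \<le> vnorm (linfty \<eta>) f"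
  using assms by (auto simp: linfty_def bounded_iff intro!: cSUP_upper bdd_aboveI2)

lemma linfty_norm_le:
  assumes "Field \<eta> \<noteq> {}" "\<And>i. i \<in> Field \<eta> \<Longrightarrow> norm (f i) \<le> C"
  shows "vnorm (linfty \<eta>) f \<le> C"
  using assms by (auto simp: linfty_def intro!: cSUP_least)

lemma linfty_ops [simp]:
  "vadd (linfty \<eta>) = (\<lambda>f g i. f i + g i)" "vscale (linfty \<eta>) = (\<lambda>c f i. c * f i)"
  by (simp_all add: linfty_def)

lemma dual_space_ops [simp]:
  "vadd (dual_space V) = (\<lambda>f g x. f x + g x)" "vscale (dual_space V) = (\<lambda>c f x. c * f x)"
  by (simp_all add: dual_space_def)

context banach_algebra
begin

abbreviation D where "D \<equiv> algebra_dual smul"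

lemma mem_dual:
  "f \<in> vcarrier D \<longleftrightarrow> (\<forall>x y. f (x + y) = f x + f y) \<and> (\<forall>c x. f (smul c x) = c * f x) \<and>
     (\<exists>C. \<forall>x. norm (f x) \<le> C * norm x)"
  by (auto simp: dual_space_def bounded_linear_map_def type_space_def)

lemma dual_add: "f \<in> vcarrier D \<Longrightarrow> f (x + y) = f x + f y"
  and dual_scale: "f \<in> vcarrier D \<Longrightarrow> f (smul c x) = c * f x"
  by (auto simp: mem_dual)

lemma dual_scaleR: "f \<in> vcarrier D \<Longrightarrow> f (r *\<^sub>R x) = of_real r * f x"
  by (simp flip: scale_of_real add: dual_scale)

lemma dual_0: "f \<in> vcarrier D \<Longrightarrow> f 0 = 0"
  using dual_scaleR[of f 0 0] by simp

lemma dual_diff: "f \<in> vcarrier D \<Longrightarrow> f (x - y) = f x - f y"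
  using dual_add[of f "x - y" y] by simp

lemma dual_sum: "f \<in> vcarrier D \<Longrightarrow> f (\<Sum>i\<in>I. smul (z i) (e i)) = (\<Sum>i\<in>I. z i * f (e i))"
  by (induction I rule: infinite_finite_induct) (auto simp: dual_0 dual_add dual_scale)

lemma dual_norm: "vnorm D f = (SUP x\<in>cball 0 1. norm (f x))"
  unfolding dual_space_def type_space_def by (simp, intro arg_cong[where f = Sup] image_cong) auto

lemma dual_norm_upper:
  assumes "f \<in> vcarrier D" "norm x \<le> 1"
  shows "norm (f x) \<le> vnorm D f"
proof -
  from assms(1) obtain C where C: "\<And>x. norm (f x) \<le> C * norm x" by (auto simp: mem_dual)
  \<comment> \<open>The absolute value is taken because the constant in
    \<open>bounded_linear_map\<close> may be negative.\<close>
  have "norm (f y) \<le> \<bar>C\<bar>" if "norm y \<le> 1" for y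
  proof -
    have "norm (f y) \<le> \<bar>C\<bar> * norm y" by (rule order_trans[OF C]) (auto intro: mult_right_mono)
    also have "\<dots> \<le> \<bar>C\<bar> * 1" using that by (intro mult_left_mono) auto
    finally show ?thesis by simp
  qed
  then have "bdd_above ((\<lambda>x. norm (f x)) ` cball 0 1)"
    by (intro bdd_aboveI2[where M = "\<bar>C\<bar>"]) auto
  then show ?thesis
    unfolding dual_norm by (rule cSUP_upper[rotated]) (use assms(2) in simp)
qed

lemma dual_norm_nonneg: "f \<in> vcarrier D \<Longrightarrow> vnorm D f \<ge> 0"
  using dual_norm_upper[of f 0] by (simp add: dual_0)

lemma dual_bound:
  assumes f: "f \<in> vcarrier D"
  shows "norm (f x) \<le> vnorm D f * norm x"
proof (cases "x = 0")
  case False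
  then have "norm (f ((1 / norm x) *\<^sub>R x)) \<le> vnorm D f" by (intro dual_norm_upper[OF f]) simp
  then show ?thesis
    using False by (simp add: dual_scaleR[OF f] norm_mult norm_divide field_simps)
qed (use f in \<open>simp add: dual_0\<close>)

lemma dual_norm_le: "(\<And>x. norm x \<le> 1 \<Longrightarrow> norm (f x) \<le> C) \<Longrightarrow> vnorm D f \<le> C"
  unfolding dual_norm by (intro cSUP_least) auto

text \<open>This carries limits over from the approximating elements
  \<open>x\<^sub>\<alpha>\<^sub>\<beta>\<close>, where functionals can be prescribed, to the
  products \<open>a\<^sub>\<alpha> b\<^sub>\<beta>\<close>.\<close>

lemma tendsto_dual:
  assumes f: "f \<in> vcarrier D" and "((\<lambda>n. norm (x n - y n)) \<longlongrightarrow> 0) F" and "((\<lambda>n. f (x n)) \<longlongrightarrow> l) F"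
  shows "((\<lambda>n. f (y n)) \<longlongrightarrow> l) F"
proof -
  have "((\<lambda>n. f (x n) - f (y n)) \<longlongrightarrow> 0) F"
  proof (rule Lim_null_comparison)
    show "((\<lambda>n. vnorm D f * norm (x n - y n)) \<longlongrightarrow> 0) F"
      using tendsto_mult_right_zero[OF assms(2)] by simp
  qed (use dual_bound[OF f] in \<open>auto simp flip: dual_diff[OF f]\<close>)
  from tendsto_diff[OF assms(3) this] show ?thesis by simp
qed

lemma dualI:
  assumes "\<And>x y. f (x + y) = f x + f y" "\<And>c x. f (smul c x) = c * f x"
    "\<And>x. norm (f x) \<le> C * norm x"
  shows "f \<in> vcarrier D"
  using assms unfolding mem_dual by blast

lemma dual_closed_add:
  assumes "f \<in> vcarrier D" "g \<in> vcarrier D"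
  shows "(\<lambda>x. f x + g x) \<in> vcarrier D"
proof (rule dualI)
  show "norm (f x + g x) \<le> (vnorm D f + vnorm D g) * norm x" for x
    using norm_triangle_mono[OF dual_bound[OF assms(1)] dual_bound[OF assms(2)]]
    by (simp add: algebra_simps)
qed (use assms in \<open>simp_all add: dual_add dual_scale algebra_simps\<close>)

lemma dual_closed_scale:
  assumes "f \<in> vcarrier D"
  shows "(\<lambda>x. c * f x) \<in> vcarrier D"
proof (rule dualI)
  show "norm (c * f x) \<le> (norm c * vnorm D f) * norm x" for x
    using mult_left_mono[OF dual_bound[OF assms], of "norm c" x] by (simp add: norm_mult algebra_simps)
qed (use assms in \<open>simp_all add: dual_add dual_scale algebra_simps\<close>)

lemma dual_closed_act:
  assumes "f \<in> vcarrier D"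
  shows "functional_act f \<phi> \<in> vcarrier D"
  unfolding functional_act_def
proof (rule dualI)
  show "norm (f (\<phi> * x)) \<le> (vnorm D f * norm \<phi>) * norm x" for x
    using order_trans[OF dual_bound[OF assms] mult_left_mono[OF norm_mult_ineq dual_norm_nonneg[OF assms]]]
    by (simp add: algebra_simps)
qed (use assms in \<open>simp_all add: dual_add dual_scale algebra_simps mult_scale_right\<close>)

section \<open>Elements of the bidual and extension of functionals\<close>

lemma mem_bidual:
  "m \<in> vcarrier (dual_space D) \<longleftrightarrow>
     (\<forall>f\<in>vcarrier D. \<forall>g\<in>vcarrier D. m (\<lambda>x. f x + g x) = m f + m g) \<and>
     (\<forall>c. \<forall>f\<in>vcarrier D. m (\<lambda>x. c * f x) = c * m f) \<and>
     (\<exists>C. \<forall>f\<in>vcarrier D. norm (m f) \<le> C * vnorm D f) \<and> (\<forall>f. f \<notin> vcarrier D \<longrightarrow> m f = 0)"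
  by (subst dual_space_def[of D]) (auto simp: bounded_linear_map_def type_space_def)

text \<open>This is the weak-star limit in the bidual of a bounded family in the algebra. The value
  0 off the dual is the normalisation built into \<open>dual_space\<close>.\<close>

lemma ulim_mem_bidual:
  assumes U: "ultrafilter U" and b: "\<forall>\<^sub>F j in U. norm (b j) \<le> R"
  shows "(\<lambda>f. if f \<in> vcarrier D then ulim U (\<lambda>j. f (b j)) else 0) \<in> vcarrier (dual_space D)"
proof -
  have bd: "\<forall>\<^sub>F j in U. norm (f (b j)) \<le> R * vnorm D f" if f: "f \<in> vcarrier D" for f
    using b
  proof eventually_elim
    case (elim j)
    have "norm (f (b j)) \<le> vnorm D f * norm (b j)" by (rule dual_bound[OF f])
    also have "\<dots> \<le> vnorm D f * R" using elim dual_norm_nonneg[OF f] by (rule mult_left_mono)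
    finally show ?case by (simp add: mult.commute)
  qed
  show ?thesis
    unfolding mem_bidual
    using ulim_add[OF U bd bd] ulim_mult[OF U bd] norm_ulim_le[OF U bd]
    by (auto simp: dual_closed_add dual_closed_scale intro!: exI[of _ R])
qed

lemma evaluation_mem_bidual:
  "(\<lambda>f. if f \<in> vcarrier D then f x else 0) \<in> vcarrier (dual_space D)"
  unfolding mem_bidual using dual_bound
  by (auto simp: dual_closed_add dual_closed_scale mult.commute intro!: exI[of _ "norm x"])

text \<open>The real parts of the second components form a real relation, to which the real theorem
  applies. The scalar-valued extension is recovered from its real part, separately for real and for
  complex scalars.\<close>

theorem Hahn_Banach_scalar_relation:
  fixes G :: "('a \<times> 'k) set"
  assumes add: "\<And>s v s' v'. (s, v) \<in> G \<Longrightarrow> (s', v') \<in> G \<Longrightarrow> (s + s', v + v') \<in> G"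
    and scale: "\<And>c s v. (s, v) \<in> G \<Longrightarrow> (smul c s, c * v) \<in> G"
    and zero: "(0, 0) \<in> G" and C: "C \<ge> 0"
    and bound: "\<And>s v. (s, v) \<in> G \<Longrightarrow> norm v \<le> C * norm s"
  shows "\<exists>F\<in>vcarrier D. \<forall>s v. (s, v) \<in> G \<longrightarrow> F s = v"
proof -
  obtain \<phi> :: "'k \<Rightarrow> complex" where \<phi>: "linear \<phi>" "\<And>x y. \<phi> (x * y) = \<phi> x * \<phi> y"
    "\<And>x. norm (\<phi> x) = norm x" "\<And>r. \<phi> (of_real r) = of_real r" "range \<phi> = \<real> \<or> range \<phi> = UNIV"
    using real_or_complex_embedding by blast
  note lin = linear_add[OF \<phi>(1)] linear_diff[OF \<phi>(1)] linear_scale[OF \<phi>(1)]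
  have inj: "x = y" if "\<phi> x = \<phi> y" for x y
    using that \<phi>(3)[of "x - y"] by (simp add: lin)
  define G' where "G' = (\<lambda>(s, v). (s, Re (\<phi> v))) ` G"
  have "Real_Vector_Spaces.subspace G'"
    unfolding real_vector.subspace_def
  proof (intro conjI ballI allI)
    show "0 \<in> G'" using zero linear_0[OF \<phi>(1)] by (force simp: G'_def zero_prod_def)
    show "p + q \<in> G'" if "p \<in> G'" "q \<in> G'" for p q
      using that add by (force simp: G'_def lin)
    show "t *\<^sub>R p \<in> G'" if p: "p \<in> G'" for p t
    proof -
      obtain s v where sv: "(s, v) \<in> G" "p = (s, Re (\<phi> v))" using p by (auto simp: G'_def)
      show ?thesis using scale[OF sv(1), of "of_real t"] sv(2)
        by (force simp: G'_def scale_of_real \<phi>)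
    qed
  qed
  moreover have "v \<le> C * norm s" if sv: "(s, v) \<in> G'" for s v
  proof -
    obtain w where "(s, w) \<in> G" "v = Re (\<phi> w)" using sv by (auto simp: G'_def)
    then show ?thesis using bound[of s w] complex_Re_le_cmod[of "\<phi> w"] by (simp add: \<phi>(3))
  qed
  ultimately obtain u where u: "linear u" "\<And>x. \<bar>u x\<bar> \<le> C * norm x" "\<And>s v. (s, v) \<in> G' \<Longrightarrow> u s = v"
    using Hahn_Banach_linear_relation[of G' C] C by blast
  have uG: "u s = Re (\<phi> v)" if "(s, v) \<in> G" for s v using u(3) that by (force simp: G'_def)
  note ulin = linear_add[OF u(1)] linear_scale[OF u(1)] linear_neg[OF u(1)]
  from \<phi>(5) show ?thesis
  proof
    assume real: "range \<phi> = \<real>"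
    \<comment> \<open>In this case every scalar is a real multiple of 1, so real linearity of
      \<open>u\<close> is already linearity over the scalar field.\<close>
    have eq: "v = of_real (Re (\<phi> v))" for v
    proof -
      have "\<phi> v \<in> \<real>" using real by auto
      then show ?thesis by (intro inj) (simp add: \<phi>(4))
    qed
    define F where "F x = (of_real (u x) :: 'k)" for x
    have "F (smul c x) = c * F x" for c x
    proof -
      have "smul c x = Re (\<phi> c) *\<^sub>R x" by (subst eq[of c]) (rule scale_of_real)
      then show ?thesis by (subst (2) eq[of c]) (simp add: F_def ulin)
    qed
    then have "F \<in> vcarrier D"
      unfolding mem_dual using u(2) by (auto simp: F_def ulin)
    moreover have "F s = v" if "(s, v) \<in> G" for s v
      using uG[OF that] eq[of v] by (simp add: F_def)
    ultimately show ?thesis by blast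
  next
    assume "range \<phi> = UNIV"
    then obtain j where j: "\<phi> j = \<i>" by (metis surjD)
    have jj: "j * j = - 1"
      by (rule inj) (use \<phi>(4)[of "-1"] in \<open>simp add: \<phi>(2) j\<close>)
    have eq: "v = of_real (Re (\<phi> v)) + j * of_real (Im (\<phi> v))" for v
      by (rule inj) (simp add: lin \<phi>(2,4) j complex_eq)
    \<comment> \<open>The functional with real part \<open>u\<close>: u x - i u (i x), where
      \<open>j\<close> plays the part of the imaginary unit.\<close>
    define F where "F x = of_real (u x) - j * of_real (u (smul j x))" for x
    have Fadd: "F (x + y) = F x + F y" for x y
      by (simp add: F_def ulin scale_right_distrib algebra_simps)
    have FR: "F (smul (of_real t) x) = of_real t * F x" for t x
    proof -
      have "smul j (t *\<^sub>R x) = t *\<^sub>R smul j x"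
        by (simp flip: scale_of_real add: mult.commute)
      then show ?thesis by (simp add: F_def scale_of_real ulin algebra_simps)
    qed
    have Fj: "F (smul j x) = j * F x" for x
    proof -
      have "smul j (smul j x) = - x" by (simp add: jj)
      moreover have "j * (j * w) = - w" for w by (simp add: jj flip: mult.assoc)
      ultimately show ?thesis by (simp add: F_def ulin right_diff_distrib)
    qed
    have "F (smul c x) = c * F x" for c x
    proof -
      have "smul c x = smul (of_real (Re (\<phi> c))) x + smul j (smul (of_real (Im (\<phi> c))) x)"
        by (subst eq[of c]) (simp only: scale_left_distrib scale_scale)
      then have "F (smul c x) = (of_real (Re (\<phi> c)) + j * of_real (Im (\<phi> c))) * F x"
        by (simp add: Fadd FR Fj algebra_simps del: scale_scale)
      then show ?thesis by (simp flip: eq)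
    qed
    \<comment> \<open>The factor 2 comes from estimating the two summands separately; any finite
      bound gives membership in the dual.\<close>
    moreover have "norm (F x) \<le> (2 * C) * norm x" for x
    proof -
      have nj: "norm j = 1" using \<phi>(3)[of j] by (simp add: j)
      have "norm (F x) \<le> \<bar>u x\<bar> + \<bar>u (smul j x)\<bar>"
        unfolding F_def using norm_triangle_ineq4[of "of_real (u x)" "j * of_real (u (smul j x))"]
        by (simp add: norm_mult nj)
      with u(2)[of x] u(2)[of "smul j x"] show ?thesis by (simp add: norm_scale nj)
    qed
    ultimately have "F \<in> vcarrier D" unfolding mem_dual using Fadd by blast
    \<comment> \<open>The graph also contains (j s, j v), and the real part of j v is minus the
      imaginary part of \<open>v\<close>, so both parts of \<open>v\<close> are recovered.\<close>
    moreover have "F s = v" if "(s, v) \<in> G" for s v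
      using uG[OF that] uG[OF scale[OF that, of j]] eq[of v] by (simp add: F_def \<phi>(2) j)
    ultimately show ?thesis by blast
  qed
qed

text \<open>The inequality says that sending a combination of the vectors \<open>e i\<close> to the
  same combination of the numbers \<open>g i\<close> is bounded. Working with the relation of all
  such pairs allows repeated or dependent \<open>e i\<close>, since the bound forces
  consistency.\<close>

theorem Helly:
  fixes e :: "'j \<Rightarrow> 'a" and g :: "'j \<Rightarrow> 'k"
  assumes "\<And>I z. finite I \<Longrightarrow> I \<subseteq> J \<Longrightarrow>
    norm (\<Sum>i\<in>I. z i * g i) \<le> C * norm (\<Sum>i\<in>I. smul (z i) (e i))"
  shows "\<exists>F\<in>vcarrier D. \<forall>i\<in>J. F (e i) = g i"
proof -
  define G where "G = {(\<Sum>i\<in>I. smul (z i) (e i), \<Sum>i\<in>I. z i * g i) | I z. finite I \<and> I \<subseteq> J}"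
  have GI: "(\<Sum>i\<in>I. smul (z i) (e i), \<Sum>i\<in>I. z i * g i) \<in> G" if "finite I" "I \<subseteq> J" for I z
    using that by (auto simp: G_def)
  have GE: "\<exists>I z. finite I \<and> I \<subseteq> J \<and> s = (\<Sum>i\<in>I. smul (z i) (e i)) \<and> v = (\<Sum>i\<in>I. z i * g i)"
    if "(s, v) \<in> G" for s v
    using that by (auto simp: G_def)
  have "(s + s', v + v') \<in> G" if sv: "(s, v) \<in> G" and sv': "(s', v') \<in> G" for s v s' v'
  proof -
    obtain I z where I: "finite I" "I \<subseteq> J" "s = (\<Sum>i\<in>I. smul (z i) (e i))" "v = (\<Sum>i\<in>I. z i * g i)"
      using GE[OF sv] by blast
    obtain I' z' where I': "finite I'" "I' \<subseteq> J" "s' = (\<Sum>i\<in>I'. smul (z' i) (e i))"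
      "v' = (\<Sum>i\<in>I'. z' i * g i)"
      using GE[OF sv'] by blast
    \<comment> \<open>Coefficients are padded by zero, so that both combinations run over the same
      finite index set.\<close>
    define w where "w i = (if i \<in> I then z i else 0)" for i
    define w' where "w' i = (if i \<in> I' then z' i else 0)" for i
    have "s = (\<Sum>i\<in>I \<union> I'. smul (w i) (e i))" "v = (\<Sum>i\<in>I \<union> I'. w i * g i)"
      using I I'(1) by (auto intro!: sum.mono_neutral_cong_left simp: w_def)
    moreover have "s' = (\<Sum>i\<in>I \<union> I'. smul (w' i) (e i))" "v' = (\<Sum>i\<in>I \<union> I'. w' i * g i)"
      using I' I(1) by (auto intro!: sum.mono_neutral_cong_left simp: w'_def)
    ultimately show ?thesis
      using GI[of "I \<union> I'" "\<lambda>i. w i + w' i"] I(1,2) I'(1,2)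
      by (simp add: scale_left_distrib distrib_right sum.distrib)
  qed
  moreover have "(smul c s, c * v) \<in> G" if sv: "(s, v) \<in> G" for c s v
  proof -
    obtain I z where I: "finite I" "I \<subseteq> J" "s = (\<Sum>i\<in>I. smul (z i) (e i))" "v = (\<Sum>i\<in>I. z i * g i)"
      using GE[OF sv] by blast
    show ?thesis
      using GI[OF I(1,2), of "\<lambda>i. c * z i"] I(3,4)
      by (simp add: scale_sum_right sum_distrib_left mult.assoc)
  qed
  moreover have "(0, 0) \<in> G" using GI[of "{}"] by simp
  moreover have "norm v \<le> \<bar>C\<bar> * norm s" if "(s, v) \<in> G" for s v
  proof -
    have "norm v \<le> C * norm s" using GE[OF that] assms by auto
    also have "\<dots> \<le> \<bar>C\<bar> * norm s" by (intro mult_right_mono) auto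
    finally show ?thesis .
  qed
  ultimately have "\<exists>F\<in>vcarrier D. \<forall>s v. (s, v) \<in> G \<longrightarrow> F s = v"
    by (intro Hahn_Banach_scalar_relation[of G "\<bar>C\<bar>"]) auto
  then obtain F where F: "F \<in> vcarrier D" "\<And>s v. (s, v) \<in> G \<Longrightarrow> F s = v" by blast
  moreover have "F (e i) = g i" if "i \<in> J" for i
    using F(2)[OF GI[of "{i}" "\<lambda>_. 1"]] that by simp
  ultimately show ?thesis by blast
qed

end


section \<open>Weakly almost periodic functionals\<close>

context banach_algebra
begin

section \<open>The weak topology of the dual\<close>

abbreviation W where "W \<equiv> weak_topology D"

lemma openin_weak:
  "m \<in> vcarrier (dual_space D) \<Longrightarrow> open G \<Longrightarrow> openin W {f \<in> vcarrier D. m f \<in> G}"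
  unfolding weak_topology_def by (intro topology_generated_by_Basis) auto

lemma topspace_weak: "topspace W = vcarrier D"
proof -
  have "(\<lambda>f. 0) \<in> vcarrier (dual_space D)"
    unfolding mem_bidual by (auto intro: exI[of _ 0])
  from openin_subset[OF openin_weak[OF this open_UNIV]] show ?thesis
    unfolding weak_topology_def by auto
qed

lemma continuous_map_bidual:
  assumes "m \<in> vcarrier (dual_space D)"
  shows "continuous_map W euclidean m"
  unfolding continuous_map_def using openin_weak[OF assms] by (auto simp: topspace_weak)

text \<open>The universal property of the initial topology: continuity is tested on the generating
  preimages.\<close>

lemma continuous_map_weak:
  assumes "\<And>x. x \<in> topspace X \<Longrightarrow> f x \<in> vcarrier D"
    and "\<And>m. m \<in> vcarrier (dual_space D) \<Longrightarrow> continuous_map X euclidean (\<lambda>x. m (f x))"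
  shows "continuous_map X W f"
  unfolding weak_topology_def
proof (rule continuous_on_generated_topo)
  show "f ` topspace X \<subseteq> \<Union> {{x \<in> vcarrier D. \<phi> x \<in> G} |\<phi> G. \<phi> \<in> vcarrier (dual_space D) \<and> open G}"
    using assms(1) topspace_weak unfolding weak_topology_def by auto
next
  fix U assume "U \<in> {{x \<in> vcarrier D. \<phi> x \<in> G} |\<phi> G. \<phi> \<in> vcarrier (dual_space D) \<and> open G}"
  then obtain m G where m: "m \<in> vcarrier (dual_space D)" "open G" and U: "U = {x \<in> vcarrier D. m x \<in> G}"
    by auto
  have "f -` U \<inter> topspace X = {x \<in> topspace X. m (f x) \<in> G}"
    using assms(1) by (auto simp: U)
  also have "openin X \<dots>"
    using assms(2)[OF m(1)] m(2) by (auto simp: continuous_map_def)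
  finally show "openin X (f -` U \<inter> topspace X)" .
qed

text \<open>Distinct functionals differ at some vector, and evaluation at that vector is an element
  of the bidual that separates them.\<close>

lemma Hausdorff_weak: "Hausdorff_space W"
  unfolding Hausdorff_space_def topspace_weak
proof (intro allI impI, elim conjE)
  fix f g assume fg: "f \<in> vcarrier D" "g \<in> vcarrier D" "f \<noteq> g"
  then obtain x where "f x \<noteq> g x" by auto
  then obtain G H where GH: "open G" "open H" "f x \<in> G" "g x \<in> H" "G \<inter> H = {}"
    by (metis hausdorff)
  define m where "m = (\<lambda>f. if f \<in> vcarrier D then f x else 0)"
  have m: "m \<in> vcarrier (dual_space D)" unfolding m_def by (rule evaluation_mem_bidual)
  show "\<exists>U V. openin W U \<and> openin W V \<and> f \<in> U \<and> g \<in> V \<and> disjnt U V"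
    using openin_weak[OF m GH(1)] openin_weak[OF m GH(2)] fg GH
    by (intro exI[of _ "{f \<in> vcarrier D. m f \<in> G}"] exI[of _ "{f \<in> vcarrier D. m f \<in> H}"])
       (auto simp: m_def disjnt_def)
qed

text \<open>A compact set is closed in a Hausdorff space and so contains the closure. Together with
  the next lemma this replaces relative compactness by inclusion in a compact set, without handling
  closures.\<close>

lemma relatively_weakly_compact_subset:
  assumes "compactin W C" "S \<subseteq> C"
  shows "relatively_weakly_compact D S"
proof -
  have "closedin W C" using compactin_imp_closedin[OF Hausdorff_weak assms(1)] .
  then have "W closure_of S \<subseteq> C" using assms(2) by (rule closure_of_minimal[rotated])
  then have "compactin W (W closure_of S)"
    by (rule closed_compactin[OF assms(1) _ closedin_closure_of])
  moreover have "C \<subseteq> vcarrier D" using compactin_subset_topspace[OF assms(1)] by (simp add: topspace_weak)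
  ultimately show ?thesis using assms(2) unfolding relatively_weakly_compact_def by auto
qed

lemma relatively_weakly_compactE:
  assumes "relatively_weakly_compact D S"
  obtains C where "compactin W C" "S \<subseteq> C"
  using assms closure_of_subset[of S W] that topspace_weak
  unfolding relatively_weakly_compact_def by blast

section \<open>The subspace of weakly almost periodic functionals\<close>

definition orbit where "orbit f = {functional_act f \<phi> | \<phi>. norm \<phi> \<le> 1}"

lemma mem_WAP: "f \<in> WAP smul \<longleftrightarrow> f \<in> vcarrier D \<and> relatively_weakly_compact D (orbit f)"
  by (simp add: WAP_def orbit_def)

lemma WAP_subset_dual: "WAP smul \<subseteq> vcarrier D"
  by (auto simp: mem_WAP)

lemma zero_mem_WAP: "(\<lambda>x. 0) \<in> WAP smul"
proof -
  have z: "(\<lambda>x. 0) \<in> vcarrier D" by (rule dualI[where C = 0]) auto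
  then have "compactin W {\<lambda>x. 0}" by (simp add: topspace_weak)
  then have "relatively_weakly_compact D (orbit (\<lambda>x. 0))"
    by (rule relatively_weakly_compact_subset) (auto simp: orbit_def functional_act_def)
  with z show ?thesis by (simp add: mem_WAP)
qed

text \<open>Addition is weakly continuous because every bidual element is additive. Hence it maps
  the product of two compact sets containing the orbits to a compact set containing the orbit of the
  sum.\<close>

lemma WAP_closed_add:
  assumes "f \<in> WAP smul" "g \<in> WAP smul"
  shows "(\<lambda>x. f x + g x) \<in> WAP smul"
proof -
  obtain A where A: "compactin W A" "orbit f \<subseteq> A"
    using assms by (auto simp: mem_WAP elim: relatively_weakly_compactE)
  obtain B where B: "compactin W B" "orbit g \<subseteq> B"
    using assms by (auto simp: mem_WAP elim: relatively_weakly_compactE)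
  define s where "s = (\<lambda>(f, g). (\<lambda>x. f x + g x) :: 'a \<Rightarrow> 'k)"
  have "continuous_map (prod_topology W W) W s"
  proof (rule continuous_map_weak)
    fix m assume m: "m \<in> vcarrier (dual_space D)"
    have "continuous_map (prod_topology W W) euclidean (\<lambda>p. m (fst p) + m (snd p))"
      using continuous_map_compose[OF continuous_map_fst continuous_map_bidual[OF m], of W]
        continuous_map_compose[OF continuous_map_snd continuous_map_bidual[OF m], of W]
      by (intro continuous_map_add) (auto simp: o_def)
    then show "continuous_map (prod_topology W W) euclidean (\<lambda>p. m (s p))"
      by (rule continuous_map_eq) (use m in \<open>auto simp: s_def mem_bidual topspace_weak\<close>)
  qed (auto simp: s_def topspace_weak dual_closed_add)
  moreover have "compactin (prod_topology W W) (A \<times> B)"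
    using A B by (simp add: compactin_Times)
  ultimately have "compactin W (s ` (A \<times> B))" by (rule image_compactin[rotated])
  moreover have "orbit (\<lambda>x. f x + g x) \<subseteq> s ` (A \<times> B)"
  proof
    fix h assume "h \<in> orbit (\<lambda>x. f x + g x)"
    then obtain \<phi> where \<phi>: "norm \<phi> \<le> 1" "h = functional_act (\<lambda>x. f x + g x) \<phi>"
      by (auto simp: orbit_def)
    then have "functional_act f \<phi> \<in> A" "functional_act g \<phi> \<in> B"
      using A(2) B(2) by (auto simp: orbit_def)
    moreover have "h = s (functional_act f \<phi>, functional_act g \<phi>)"
      by (simp add: \<phi>(2) s_def functional_act_def)
    ultimately show "h \<in> s ` (A \<times> B)" by blast
  qed
  ultimately have "relatively_weakly_compact D (orbit (\<lambda>x. f x + g x))"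
    by (rule relatively_weakly_compact_subset)
  with assms show ?thesis by (simp add: mem_WAP dual_closed_add)
qed

lemma WAP_closed_scale:
  assumes "f \<in> WAP smul"
  shows "(\<lambda>x. c * f x) \<in> WAP smul"
proof -
  obtain A where A: "compactin W A" "orbit f \<subseteq> A"
    using assms by (auto simp: mem_WAP elim: relatively_weakly_compactE)
  define s where "s f = (\<lambda>x. c * f x)" for f :: "'a \<Rightarrow> 'k"
  have "continuous_map W W s"
  proof (rule continuous_map_weak)
    fix m assume m: "m \<in> vcarrier (dual_space D)"
    have "continuous_map euclidean euclidean (\<lambda>z::'k. c * z)"
      by (auto intro: continuous_intros)
    from continuous_map_compose[OF continuous_map_bidual[OF m] this]
    have "continuous_map W euclidean (\<lambda>p. c * m p)" by (simp add: o_def)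
    then show "continuous_map W euclidean (\<lambda>p. m (s p))"
      by (rule continuous_map_eq) (use m in \<open>auto simp: s_def mem_bidual topspace_weak\<close>)
  qed (auto simp: s_def topspace_weak dual_closed_scale)
  with A(1) have "compactin W (s ` A)" by (rule image_compactin)
  moreover have "orbit (\<lambda>x. c * f x) \<subseteq> s ` A"
    using A(2) by (fastforce simp: orbit_def s_def functional_act_def)
  ultimately have "relatively_weakly_compact D (orbit (\<lambda>x. c * f x))"
    by (rule relatively_weakly_compact_subset)
  with assms show ?thesis by (simp add: mem_WAP dual_closed_scale)
qed

text \<open>If no point of \<open>K\<close> were a limit, each would have an open neighbourhood that
  \<open>h\<close> eventually avoids. Finitely many of these cover \<open>K\<close>, so
  \<open>h\<close> would eventually avoid \<open>K\<close>.\<close>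

lemma compactin_ultrafilter:
  assumes K: "compactin X K" and U: "ultrafilter U" and h: "\<forall>\<^sub>F i in U. h i \<in> K"
  obtains g where "g \<in> K" "\<And>N. openin X N \<Longrightarrow> g \<in> N \<Longrightarrow> \<forall>\<^sub>F i in U. h i \<in> N"
proof -
  have "\<exists>g\<in>K. \<forall>N. openin X N \<longrightarrow> g \<in> N \<longrightarrow> (\<forall>\<^sub>F i in U. h i \<in> N)"
  proof (rule ccontr)
    assume not: "\<not> ?thesis"
    define \<U> where "\<U> = {N. openin X N \<and> (\<forall>\<^sub>F i in U. h i \<notin> N)}"
    have "K \<subseteq> \<Union> \<U>"
      using not ultrafilter_not_eventually[OF U] by (fastforce simp: \<U>_def)
    then obtain \<F> where \<F>: "finite \<F>" "\<F> \<subseteq> \<U>" "K \<subseteq> \<Union> \<F>"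
      using K unfolding compactin_def by (metis (no_types, lifting) \<U>_def mem_Collect_eq)
    then have "\<forall>\<^sub>F i in U. \<forall>N\<in>\<F>. h i \<notin> N"
      by (intro eventually_ball_finite) (auto simp: \<U>_def)
    with h have "\<forall>\<^sub>F i in U. False"
      by eventually_elim (use \<F>(3) in auto)
    then show False using ultrafilter_not_bot[OF U] by (simp add: trivial_limit_def)
  qed
  then show ?thesis using that by blast
qed

text \<open>One direction of Grothendieck's double limit criterion. The translates of
  \<open>f\<close> by the rescaled \<open>a i\<close> lie in a weakly compact set, so they have a
  weak limit \<open>g\<close> along \<open>U\<close>; up to the scaling factor both iterated limits
  equal the limit of g (b j) along \<open>V\<close>.\<close>

theorem WAP_iterated_limits:
  assumes f: "f \<in> WAP smul" and U: "ultrafilter U" and V: "ultrafilter V"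
    and a: "\<forall>\<^sub>F i in U. norm (a i) \<le> R" and b: "\<forall>\<^sub>F j in V. norm (b j) \<le> R'"
  shows "ulim U (\<lambda>i. ulim V (\<lambda>j. f (a i * b j))) = ulim V (\<lambda>j. ulim U (\<lambda>i. f (a i * b j)))"
proof -
  \<comment> \<open>Dividing by \<open>t\<close> moves the \<open>a i\<close> into the unit ball;
    the maximum with 1 keeps \<open>t\<close> positive whatever \<open>R\<close> is.\<close>
  define t where "t = max R 1"
  define h where "h i = functional_act f ((1 / t) *\<^sub>R a i)" for i
  have t: "t > 0" "R \<le> t" by (auto simp: t_def)
  have fD: "f \<in> vcarrier D" using f by (simp add: mem_WAP)
  have hD: "h i \<in> vcarrier D" for i unfolding h_def by (rule dual_closed_act[OF fD])
  have fh: "f (a i * x) = of_real t * h i x" for i x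
    using t by (simp add: h_def functional_act_def dual_scaleR[OF fD])
  obtain K where K: "compactin W K" "orbit f \<subseteq> K"
    using f by (auto simp: mem_WAP elim: relatively_weakly_compactE)
  have "\<forall>\<^sub>F i in U. h i \<in> K"
    using a
  proof eventually_elim
    case (elim i)
    with t have "norm ((1 / t) *\<^sub>R a i) \<le> 1" by (simp add: field_simps)
    then have "h i \<in> orbit f" unfolding orbit_def h_def by blast
    then show ?case using K(2) by blast
  qed
  then obtain g where gK: "g \<in> K" and g: "\<And>N. openin W N \<Longrightarrow> g \<in> N \<Longrightarrow> \<forall>\<^sub>F i in U. h i \<in> N"
    using compactin_ultrafilter[OF K(1) U] by blast
  have gD: "g \<in> vcarrier D" using gK compactin_subset_topspace[OF K(1)] by (auto simp: topspace_weak)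
  have lim: "((\<lambda>i. m (h i)) \<longlongrightarrow> m g) U" if m: "m \<in> vcarrier (dual_space D)" for m
  proof (rule topological_tendstoI)
    fix S assume "open S" "m g \<in> S"
    with g[OF openin_weak[OF m]] gD have "\<forall>\<^sub>F i in U. h i \<in> {f \<in> vcarrier D. m f \<in> S}" by auto
    then show "\<forall>\<^sub>F i in U. m (h i) \<in> S" by (rule eventually_mono) auto
  qed
  have hb: "\<forall>\<^sub>F j in V. norm (k (b j)) \<le> vnorm D k * R'" if k: "k \<in> vcarrier D" for k
    using b
  proof eventually_elim
    case (elim j)
    have "norm (k (b j)) \<le> vnorm D k * norm (b j)" by (rule dual_bound[OF k])
    also have "\<dots> \<le> vnorm D k * R'" using elim dual_norm_nonneg[OF k] by (rule mult_left_mono)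
    finally show ?case .
  qed
  \<comment> \<open>Weak convergence is tested against the limit of the \<open>b j\<close> along
    \<open>V\<close>, taken in the bidual. This is where convergence stronger than pointwise
    enters.\<close>
  have "((\<lambda>i. ulim V (\<lambda>j. h i (b j))) \<longlongrightarrow> ulim V (\<lambda>j. g (b j))) U"
    using lim[OF ulim_mem_bidual[OF V b]] by (simp add: hD gD)
  then have "((\<lambda>i. of_real t * ulim V (\<lambda>j. h i (b j))) \<longlongrightarrow> of_real t * ulim V (\<lambda>j. g (b j))) U"
    by (intro tendsto_intros)
  moreover have "ulim V (\<lambda>j. f (a i * b j)) = of_real t * ulim V (\<lambda>j. h i (b j))" for i
    unfolding fh by (rule ulim_mult[OF V hb[OF hD]])
  ultimately have "ulim U (\<lambda>i. ulim V (\<lambda>j. f (a i * b j))) = of_real t * ulim V (\<lambda>j. g (b j))"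
    by (intro ulim_eq[OF U]) simp
  \<comment> \<open>For the other order of limits, testing against evaluation at \<open>b j\<close>
    is enough.\<close>
  moreover have "ulim U (\<lambda>i. f (a i * b j)) = of_real t * g (b j)" for j
  proof -
    have "((\<lambda>i. h i (b j)) \<longlongrightarrow> g (b j)) U"
      using lim[OF evaluation_mem_bidual[of "b j"]] by (simp add: hD gD)
    then show ?thesis
      unfolding fh by (intro ulim_eq[OF U] tendsto_intros)
  qed
  moreover have "ulim V (\<lambda>j. of_real t * g (b j)) = of_real t * ulim V (\<lambda>j. g (b j))"
    by (rule ulim_mult[OF V hb[OF gD]])
  ultimately show ?thesis by simp
qed

section \<open>The quotient of the dual by the weakly almost periodic functionals\<close>

abbreviation Q where "Q \<equiv> quotient_space D (WAP smul)"
abbreviation cs where "cs \<equiv> coset D (WAP smul)"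

lemma mem_coset: "h \<in> cs f \<longleftrightarrow> (\<exists>w\<in>WAP smul. h = (\<lambda>x. f x + w x))"
  by (auto simp: coset_def)

lemma self_mem_coset: "f \<in> cs f"
  unfolding mem_coset by (rule bexI[OF _ zero_mem_WAP]) simp

lemma coset_subset_dual: "f \<in> vcarrier D \<Longrightarrow> cs f \<subseteq> vcarrier D"
  using WAP_subset_dual by (auto simp: mem_coset intro!: dual_closed_add)

lemma Q_carrier: "vcarrier Q = cs ` vcarrier D"
  by (simp add: quotient_space_def)

lemma Q_add: "vadd Q (cs f) (cs g) = cs (\<lambda>x. f x + g x)"
proof (intro equalityI subsetI)
  fix h assume "h \<in> vadd Q (cs f) (cs g)"
  then obtain v w where "v \<in> WAP smul" "w \<in> WAP smul" "h = (\<lambda>x. (f x + v x) + (g x + w x))"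
    by (auto simp: quotient_space_def coset_def)
  then show "h \<in> cs (\<lambda>x. f x + g x)"
    unfolding mem_coset by (intro bexI[of _ "\<lambda>x. v x + w x"]) (auto simp: WAP_closed_add)
next
  fix h assume "h \<in> cs (\<lambda>x. f x + g x)"
  then obtain w where "w \<in> WAP smul" "h = (\<lambda>x. f x + g x + w x)" by (auto simp: mem_coset)
  then have "(\<lambda>x. f x + w x) \<in> cs f" "h = (\<lambda>x. (f x + w x) + g x)" by (auto simp: mem_coset)
  moreover have "g \<in> cs g" by (rule self_mem_coset)
  ultimately show "h \<in> vadd Q (cs f) (cs g)" by (auto simp: quotient_space_def)
qed

lemma Q_scale: "vscale Q c (cs f) = cs (\<lambda>x. c * f x)"
proof (intro equalityI subsetI)
  fix h assume "h \<in> vscale Q c (cs f)"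
  then obtain v w where "v \<in> WAP smul" "w \<in> WAP smul" "h = (\<lambda>x. c * (f x + v x) + w x)"
    by (auto simp: quotient_space_def coset_def)
  then show "h \<in> cs (\<lambda>x. c * f x)"
    unfolding mem_coset
    by (intro bexI[of _ "\<lambda>x. c * v x + w x"])
       (auto simp: WAP_closed_add WAP_closed_scale algebra_simps)
next
  fix h assume "h \<in> cs (\<lambda>x. c * f x)"
  then obtain w where "w \<in> WAP smul" "h = (\<lambda>x. c * f x + w x)" by (auto simp: mem_coset)
  moreover have "f \<in> cs f" by (rule self_mem_coset)
  ultimately show "h \<in> vscale Q c (cs f)" by (auto simp: quotient_space_def)
qed

lemma Q_norm: "vnorm Q C = (INF f\<in>C. vnorm D f)"
  by (simp add: quotient_space_def)

lemma Q_norm_nonneg: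
  assumes "C \<in> vcarrier Q"
  shows "vnorm Q C \<ge> 0"
proof -
  obtain f where f: "C = cs f" "f \<in> vcarrier D" using assms by (auto simp: Q_carrier)
  show ?thesis
    unfolding Q_norm f(1)
  proof (rule cINF_greatest)
    show "cs f \<noteq> {}" using self_mem_coset[of f] by blast
    show "vnorm D h \<ge> 0" if "h \<in> cs f" for h
      using that coset_subset_dual[OF f(2)] by (intro dual_norm_nonneg) auto
  qed
qed

text \<open>A map that kills the subspace is constant on cosets, so its image of a coset is a
  singleton and \<open>the_elem\<close> yields the induced map. Killing is expressed as adding
  nothing to any value, because an \<open>nspace\<close> carries no zero element.\<close>

theorem quotient_map_onto:
  assumes T: "bounded_linear_onto D L T"
    and kills: "\<And>f w. f \<in> vcarrier D \<Longrightarrow> w \<in> WAP smul \<Longrightarrow> vadd L (T f) (T w) = T f"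
  shows "bounded_linear_onto Q L (\<lambda>C. the_elem (T ` C))"
proof -
  have add: "T (\<lambda>x. f x + g x) = vadd L (T f) (T g)" if "f \<in> vcarrier D" "g \<in> vcarrier D" for f g
    using T that by (simp add: bounded_linear_onto_def bounded_linear_map_def)
  have scale: "T (\<lambda>x. c * f x) = vscale L c (T f)" if "f \<in> vcarrier D" for f c
    using T that by (simp add: bounded_linear_onto_def bounded_linear_map_def)
  obtain C0 where C0: "\<And>f. f \<in> vcarrier D \<Longrightarrow> vnorm L (T f) \<le> C0 * vnorm D f"
    using T unfolding bounded_linear_onto_def bounded_linear_map_def by blast
  have Tcs: "T h = T f" if "h \<in> cs f" "f \<in> vcarrier D" for f h
    using that kills WAP_subset_dual by (auto simp: mem_coset add)
  have csD: "h \<in> vcarrier D" if "h \<in> cs f" "f \<in> vcarrier D" for f h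
    using that coset_subset_dual by blast
  have the: "the_elem (T ` cs f) = T f" if "f \<in> vcarrier D" for f
  proof -
    have "T ` cs f = (\<lambda>_. T f) ` cs f" by (intro image_cong refl Tcs[OF _ that])
    then have "T ` cs f = {T f}" using self_mem_coset[of f] by (simp add: image_constant)
    then show ?thesis by simp
  qed
  \<comment> \<open>The constant is raised to at least 1 so that one can divide by it and pass to
    the infimum over the coset.\<close>
  have norm: "vnorm L (T f) \<le> max C0 1 * vnorm Q (cs f)" if f: "f \<in> vcarrier D" for f
  proof -
    have "vnorm L (T f) / max C0 1 \<le> vnorm D h" if h: "h \<in> cs f" for h
    proof -
      have "vnorm L (T f) \<le> C0 * vnorm D h" using C0[OF csD[OF h f]] Tcs[OF h f] by simp
      also have "\<dots> \<le> max C0 1 * vnorm D h"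
        by (intro mult_right_mono dual_norm_nonneg csD[OF h f]) auto
      finally show ?thesis by (simp add: field_simps max_def split: if_splits)
    qed
    then have "vnorm L (T f) / max C0 1 \<le> vnorm Q (cs f)"
      unfolding Q_norm using self_mem_coset[of f] by (intro cINF_greatest) auto
    then show ?thesis by (simp add: field_simps max_def split: if_splits)
  qed
  have im: "T ` vcarrier D = vcarrier L" using T by (simp add: bounded_linear_onto_def)
  show ?thesis
    unfolding bounded_linear_onto_def bounded_linear_map_def Q_carrier
  proof (intro conjI exI ballI allI)
    show "(\<lambda>C. the_elem (T ` C)) ` cs ` vcarrier D \<subseteq> vcarrier L" using im by (auto simp: the)
    show "(\<lambda>C. the_elem (T ` C)) ` cs ` vcarrier D = vcarrier L"
      unfolding image_image using im the by (simp cong: image_cong)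
    show "vnorm L (the_elem (T ` C)) \<le> max C0 1 * vnorm Q C" if "C \<in> cs ` vcarrier D" for C
      using that norm by (auto simp: the)
  qed (auto simp: Q_add Q_scale the add scale dual_closed_add dual_closed_scale)
qed

end


section \<open>Mapping the quotient onto bounded functions\<close>

context banach_algebra
begin

section \<open>Differences of iterated limits as functionals on the quotient\<close>

definition limit_gap ::
    "('i \<Rightarrow> 'a) \<Rightarrow> ('j \<Rightarrow> 'a) \<Rightarrow> 'i filter \<Rightarrow> 'j filter \<Rightarrow> ('a \<Rightarrow> 'k) \<Rightarrow> 'k" where
  "limit_gap a b U V f =
     ulim2 U V (\<lambda>i j. f (a i * b j)) - ulim2 V U (\<lambda>j i. f (a i * b j))"

lemma
  assumes U: "ultrafilter U" and V: "ultrafilter V"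
    and a: "\<forall>\<^sub>F i in U. norm (a i) \<le> R" and b: "\<forall>\<^sub>F j in V. norm (b j) \<le> R'"
    and f: "f \<in> vcarrier D"
  shows limit_gap_add: "g \<in> vcarrier D \<Longrightarrow>
      limit_gap a b U V (\<lambda>x. f x + g x) = limit_gap a b U V f + limit_gap a b U V g"
    and limit_gap_scale: "limit_gap a b U V (\<lambda>x. c * f x) = c * limit_gap a b U V f"
    and limit_gap_norm: "norm (limit_gap a b U V f) \<le> (2 * (R * R')) * vnorm D f"
proof -
  have bd: "norm (h (x * y)) \<le> R * R' * vnorm D h"
    if "h \<in> vcarrier D" "norm x \<le> R" "norm y \<le> R'" for h x y
  proof -
    have "norm (h (x * y)) \<le> vnorm D h * norm (x * y)" by (rule dual_bound[OF that(1)])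
    also have "\<dots> \<le> vnorm D h * (norm x * norm y)"
      by (intro mult_left_mono norm_mult_ineq dual_norm_nonneg that)
    also have "\<dots> \<le> vnorm D h * (R * R')"
      using that by (intro mult_left_mono mult_mono dual_norm_nonneg order_trans[OF norm_ge_zero]) auto
    finally show ?thesis by (simp add: mult.commute)
  qed
  have 1: "\<forall>\<^sub>F i in U. \<forall>\<^sub>F j in V. norm (h (a i * b j)) \<le> R * R' * vnorm D h"
    if h: "h \<in> vcarrier D" for h
    using a
  proof eventually_elim
    case (elim i)
    show ?case using b by eventually_elim (rule bd[OF h elim])
  qed
  have 2: "\<forall>\<^sub>F j in V. \<forall>\<^sub>F i in U. norm (h (a i * b j)) \<le> R * R' * vnorm D h"
    if h: "h \<in> vcarrier D" for h
    using b
  proof eventually_elim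
    case (elim j)
    show ?case using a by eventually_elim (rule bd[OF h _ elim])
  qed
  show "limit_gap a b U V (\<lambda>x. f x + g x) = limit_gap a b U V f + limit_gap a b U V g"
    if "g \<in> vcarrier D"
    unfolding limit_gap_def
    using ulim2_add[OF U V 1[OF f] 1[OF that]] ulim2_add[OF V U 2[OF f] 2[OF that]]
    by simp
  show "limit_gap a b U V (\<lambda>x. c * f x) = c * limit_gap a b U V f"
    unfolding limit_gap_def
    using ulim2_mult[OF U V 1[OF f], of c] ulim2_mult[OF V U 2[OF f], of c]
    by (simp add: right_diff_distrib)
  show "norm (limit_gap a b U V f) \<le> (2 * (R * R')) * vnorm D f"
    unfolding limit_gap_def
    using norm_triangle_ineq4[of "ulim2 U V (\<lambda>i j. f (a i * b j))" "ulim2 V U (\<lambda>j i. f (a i * b j))"]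
      norm_ulim2_le[OF U V 1[OF f]] norm_ulim2_le[OF V U 2[OF f]]
    by simp
qed

lemma limit_gap_WAP:
  assumes "ultrafilter U" "ultrafilter V" "\<forall>\<^sub>F i in U. norm (a i) \<le> R" "\<forall>\<^sub>F j in V. norm (b j) \<le> R'"
    and "f \<in> WAP smul"
  shows "limit_gap a b U V f = 0"
  using WAP_iterated_limits[OF assms(5,1,2,3,4)] by (simp add: limit_gap_def ulim2_def)

text \<open>The gaps are the coordinates of one map, bounded uniformly in \<open>i\<close> because
  \<open>R\<close> and \<open>R'\<close> are. Both families of ultrafilters may vary, so that the
  statement covers pieces of either index set; the other family is then constant.\<close>

theorem limit_gaps_onto_linfty:
  fixes \<eta> :: "'c rel" and U :: "'c \<Rightarrow> 'i filter" and V :: "'c \<Rightarrow> 'j filter"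
  assumes ne: "Field \<eta> \<noteq> {}"
    and U: "\<And>i. i \<in> Field \<eta> \<Longrightarrow> ultrafilter (U i)" and V: "\<And>i. i \<in> Field \<eta> \<Longrightarrow> ultrafilter (V i)"
    and a: "\<And>i. i \<in> Field \<eta> \<Longrightarrow> \<forall>\<^sub>F \<alpha> in U i. norm (a \<alpha>) \<le> R"
    and b: "\<And>i. i \<in> Field \<eta> \<Longrightarrow> \<forall>\<^sub>F \<beta> in V i. norm (b \<beta>) \<le> R'"
    and onto: "\<And>c. c \<in> vcarrier (linfty \<eta>) \<Longrightarrow>
      \<exists>F\<in>vcarrier D. \<forall>i\<in>Field \<eta>. limit_gap a b (U i) (V i) F = c i"
  shows "\<exists>T. bounded_linear_onto Q (linfty \<eta> :: ('k, 'c \<Rightarrow> 'k) nspace) T"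
proof -
  define T where "T f = (\<lambda>i. if i \<in> Field \<eta> then limit_gap a b (U i) (V i) f else 0)" for f
  note gap = U V a b
  have norm: "norm (T f i) \<le> (2 * (R * R')) * vnorm D f" if "i \<in> Field \<eta>" "f \<in> vcarrier D" for f i
    using that limit_gap_norm[OF gap] by (simp add: T_def)
  have "bounded_linear_onto D (linfty \<eta>) T"
    unfolding bounded_linear_onto_def bounded_linear_map_def
  proof (intro conjI exI ballI allI)
    have in_l: "T f \<in> vcarrier (linfty \<eta>)" if "f \<in> vcarrier D" for f
      unfolding mem_linfty using norm that by (auto simp: T_def)
    then show "T ` vcarrier D \<subseteq> vcarrier (linfty \<eta>)" by auto
    show "T ` vcarrier D = vcarrier (linfty \<eta>)"
    proof (intro equalityI subsetI)
      fix c :: "'c \<Rightarrow> 'k" assume c: "c \<in> vcarrier (linfty \<eta>)"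
      then obtain F where F: "F \<in> vcarrier D" "\<And>i. i \<in> Field \<eta> \<Longrightarrow> limit_gap a b (U i) (V i) F = c i"
        using onto by blast
      then have "T F = c" using c by (auto simp: T_def mem_linfty)
      with F(1) show "c \<in> T ` vcarrier D" by auto
    qed (use in_l in auto)
    show "T (vadd D f g) = vadd (linfty \<eta>) (T f) (T g)" if "f \<in> vcarrier D" "g \<in> vcarrier D" for f g
      using that limit_gap_add[OF gap] by (auto simp: T_def)
    show "T (vscale D c f) = vscale (linfty \<eta>) c (T f)" if "f \<in> vcarrier D" for c f
      using that limit_gap_scale[OF gap] by (auto simp: T_def)
    show "vnorm (linfty \<eta>) (T f) \<le> (2 * (R * R')) * vnorm D f" if "f \<in> vcarrier D" for f
      using ne norm that by (intro linfty_norm_le)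
  qed
  then have "bounded_linear_onto Q (linfty \<eta>) (\<lambda>C. the_elem (T ` C))"
    by (rule quotient_map_onto) (use limit_gap_WAP[OF gap] in \<open>auto simp: T_def\<close>)
  then show ?thesis by blast
qed

text \<open>Evaluation at normalised points of a dense set is an embedding \<open>J\<close> of the
  dual into the bounded functions. The subspace \<open>S\<close> is the preimage of its range under
  \<open>T\<close>, and \<open>T\<close> followed by the inverse of \<open>J\<close> maps
  \<open>S\<close> onto the dual.\<close>

theorem linfty_onto_imp_extremely_non_Arens_regular:
  fixes \<eta> :: "'c rel"
  assumes "Cinfinite \<eta>" and dens: "density_character (UNIV :: 'a set) \<le>o \<eta>"
    and T: "bounded_linear_onto Q (linfty \<eta> :: ('k, 'c \<Rightarrow> 'k) nspace) T"
  shows "extremely_non_Arens_regular smul"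
proof -
  let ?L = "linfty \<eta> :: ('k, 'c \<Rightarrow> 'k) nspace"
  have card: "Card_order \<eta>" and ne: "Field \<eta> \<noteq> {}"
    using assms(1) by (auto simp: cinfinite_def)
  have "{S. S \<subseteq> UNIV \<and> (UNIV :: 'a set) \<subseteq> closure S} \<noteq> {}" using closure_UNIV by blast
  then obtain E0 :: "'a set" where S0: "closure E0 = UNIV" "density_character (UNIV :: 'a set) = |E0|"
    unfolding density_character_def by (rule min_card_attained) auto
  have "|E0| \<le>o |Field \<eta>|"
    using dens S0(2) card by (metis card_of_Field_ordIso ordIso_symmetric ordLeq_ordIso_trans)
  moreover have "E0 \<noteq> {}" using S0(1) by auto
  ultimately obtain e where e: "e ` Field \<eta> = E0" using card_of_ordLeq2[of E0 "Field \<eta>"] by metis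
  \<comment> \<open>Scaling by \<open>max 1\<close> pulls points into the unit ball, fixes those
    already there, and never divides by zero.\<close>
  define u where "u i = (1 / max 1 (norm (e i))) *\<^sub>R e i" for i
  have u1: "norm (u i) \<le> 1" for i by (simp add: u_def field_simps)
  \<comment> \<open>The points \<open>u i\<close> determine the norm: a sequence from the dense set
    converging to a point of the ball still does so after this scaling.\<close>
  have norm_le: "vnorm D f \<le> s"
    if f: "f \<in> vcarrier D" and s: "\<And>i. i \<in> Field \<eta> \<Longrightarrow> norm (f (u i)) \<le> s" for f s
  proof (rule dual_norm_le)
    fix x :: 'a assume x: "norm x \<le> 1"
    obtain d where d: "\<And>n. d n \<in> E0" "d \<longlonglongrightarrow> x" using S0(1) closure_sequential[of x E0] by auto
    define y where "y n = (1 / max 1 (norm (d n))) *\<^sub>R d n" for n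
    have "y \<longlonglongrightarrow> (1 / max 1 (norm x)) *\<^sub>R x"
      unfolding y_def by (intro tendsto_intros d(2)) auto
    then have "y \<longlonglongrightarrow> x" using x by (simp add: max_absorb1)
    then have "(\<lambda>n. norm (x - y n)) \<longlonglongrightarrow> 0"
      by (subst norm_minus_commute) (simp add: LIM_zero tendsto_norm_zero)
    then have "(\<lambda>n. f (y n)) \<longlonglongrightarrow> f x" by (rule tendsto_dual[OF f]) simp
    then have "(\<lambda>n. norm (f (y n))) \<longlonglongrightarrow> norm (f x)" by (rule tendsto_norm)
    moreover have "norm (f (y n)) \<le> s" for n
    proof -
      obtain i where "i \<in> Field \<eta>" "d n = e i" using d(1)[of n] e by auto
      then show ?thesis using s[of i] by (simp add: y_def u_def)
    qed
    ultimately show "norm (f x) \<le> s" by (intro LIMSEQ_le_const2) auto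
  qed
  define J where "J f = (\<lambda>i. if i \<in> Field \<eta> then f (u i) else 0)" for f :: "'a \<Rightarrow> 'k"
  have J_in: "J f \<in> vcarrier ?L" if f: "f \<in> vcarrier D" for f
  proof -
    have "norm (f (u i)) \<le> vnorm D f" for i
      using dual_bound[OF f, of "u i"] mult_left_mono[OF u1[of i] dual_norm_nonneg[OF f]] by simp
    then show ?thesis unfolding mem_linfty by (auto simp: J_def)
  qed
  have J_norm: "vnorm D f \<le> vnorm ?L (J f)" if f: "f \<in> vcarrier D" for f
    by (rule norm_le[OF f]) (use norm_le_linfty_norm[OF J_in[OF f]] in \<open>auto simp: J_def\<close>)
  have J_add: "J (\<lambda>x. f x + g x) = (\<lambda>i. J f i + J g i)" and J_scale: "J (\<lambda>x. c * f x) = (\<lambda>i. c * J f i)"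
    for f g c by (auto simp: J_def)
  have J_inj: "f = g" if fg: "f \<in> vcarrier D" "g \<in> vcarrier D" "J f = J g" for f g
  proof
    fix x
    let ?h = "\<lambda>x. f x + (- 1) * g x"
    have h: "?h \<in> vcarrier D" by (intro dual_closed_add dual_closed_scale fg)
    have "f (u i) = g (u i)" if "i \<in> Field \<eta>" for i
      using fun_cong[OF fg(3), of i] that by (simp add: J_def)
    then have "vnorm D ?h \<le> 0" by (intro norm_le[OF h]) auto
    with dual_norm_nonneg[OF h] have "vnorm D ?h = 0" by simp
    with dual_bound[OF h, of x] show "f x = g x" by simp
  qed
  have T_in: "T C \<in> vcarrier ?L" if "C \<in> vcarrier Q" for C
    using T that by (auto simp: bounded_linear_onto_def)
  have T_onto: "\<exists>C\<in>vcarrier Q. T C = c" if "c \<in> vcarrier ?L" for c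
    using T that unfolding bounded_linear_onto_def by (metis imageE)
  have T_add: "T (vadd Q C E) = (\<lambda>i. T C i + T E i)" if "C \<in> vcarrier Q" "E \<in> vcarrier Q" for C E
    using T that by (auto simp: bounded_linear_onto_def bounded_linear_map_def)
  have T_scale: "T (vscale Q c C) = (\<lambda>i. c * T C i)" if "C \<in> vcarrier Q" for c C
    using T that by (auto simp: bounded_linear_onto_def bounded_linear_map_def)
  obtain C0 where C0: "\<And>C. C \<in> vcarrier Q \<Longrightarrow> vnorm ?L (T C) \<le> C0 * vnorm Q C"
    using T unfolding bounded_linear_onto_def bounded_linear_map_def by blast
  have Q_add_in: "vadd Q C E \<in> vcarrier Q" if "C \<in> vcarrier Q" "E \<in> vcarrier Q" for C E
    using that by (auto simp: Q_carrier Q_add dual_closed_add)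
  have Q_scale_in: "vscale Q c C \<in> vcarrier Q" if "C \<in> vcarrier Q" for C c
    using that by (auto simp: Q_carrier Q_scale dual_closed_scale)
  define S where "S = {C \<in> vcarrier Q. T C \<in> J ` vcarrier D}"
  \<comment> \<open>The range of \<open>J\<close> is closed. The image of \<open>C\<close> is a
    uniform limit of functions \<open>J f\<close>, whose functionals give Helly's inequality for the
    limit up to an arbitrarily small error; Helly then represents the limit as
    \<open>J F\<close>.\<close>
  have closed: "C \<in> S"
    if C: "C \<in> vcarrier Q" and lim: "\<And>\<epsilon>. \<epsilon> > 0 \<Longrightarrow> \<exists>E\<in>S. vnorm Q (vadd Q C (vscale Q (- 1) E)) < \<epsilon>" for C
  proof -
    define g where "g = T C"
    define N where "N = vnorm ?L g"
    have gL: "g \<in> vcarrier ?L" unfolding g_def using C by (rule T_in)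
    have approx: "\<exists>f\<in>vcarrier D. \<forall>i\<in>Field \<eta>. norm (g i - f (u i)) \<le> \<delta>" if \<delta>: "\<delta> > 0" for \<delta>
    proof -
      \<comment> \<open>Adding 1 to the absolute value makes the divisor positive even when
        \<open>C0\<close> is not.\<close>
      obtain E where E: "E \<in> S" "vnorm Q (vadd Q C (vscale Q (- 1) E)) < \<delta> / (\<bar>C0\<bar> + 1)"
        using lim[of "\<delta> / (\<bar>C0\<bar> + 1)"] \<delta> by auto
      then obtain f where f: "f \<in> vcarrier D" "T E = J f" and EQ: "E \<in> vcarrier Q" by (auto simp: S_def)
      let ?X = "vadd Q C (vscale Q (- 1) E)"
      have X: "?X \<in> vcarrier Q" using C EQ by (intro Q_add_in Q_scale_in)
      have "vnorm ?L (T ?X) \<le> C0 * vnorm Q ?X" by (rule C0[OF X])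
      also have "\<dots> \<le> (\<bar>C0\<bar> + 1) * vnorm Q ?X" using Q_norm_nonneg[OF X] by (intro mult_right_mono) auto
      also have "\<dots> \<le> \<delta>" using E(2) by (simp add: field_simps)
      finally have "norm (T ?X i) \<le> \<delta>" if "i \<in> Field \<eta>" for i
        using norm_le_linfty_norm[OF T_in[OF X] that] by simp
      then have "\<forall>i\<in>Field \<eta>. norm (g i - f (u i)) \<le> \<delta>"
        using C EQ f(2) by (simp add: T_add T_scale Q_scale_in g_def J_def)
      with f(1) show ?thesis by blast
    qed
    have "\<exists>F\<in>vcarrier D. \<forall>i\<in>Field \<eta>. F (u i) = g i"
    proof (rule Helly[where C = N])
      fix I :: "'c set" and z :: "'c \<Rightarrow> 'k" assume I: "finite I" "I \<subseteq> Field \<eta>"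
      let ?y = "\<Sum>i\<in>I. smul (z i) (u i)"
      \<comment> \<open>The total error is \<delta> times \<open>Z\<close>: one term from the norm
        bound N + \<delta> on the approximating functional, the other from its errors at the points
        \<open>u i\<close>.\<close>
      define Z where "Z = norm ?y + (\<Sum>i\<in>I. norm (z i))"
      have Z: "Z \<ge> 0" unfolding Z_def by (intro add_nonneg_nonneg sum_nonneg) auto
      have *: "norm (\<Sum>i\<in>I. z i * g i) \<le> N * norm ?y + \<delta> * Z" if \<delta>: "\<delta> > 0" for \<delta>
      proof -
        obtain f where f: "f \<in> vcarrier D" "\<And>i. i \<in> Field \<eta> \<Longrightarrow> norm (g i - f (u i)) \<le> \<delta>"
          using approx[OF \<delta>] by blast
        have "norm (f (u i)) \<le> N + \<delta>" if "i \<in> Field \<eta>" for i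
          using norm_triangle_ineq2[of "f (u i)" "g i"] f(2)[OF that] norm_le_linfty_norm[OF gL that]
          by (simp add: N_def norm_minus_commute)
        then have nf: "vnorm D f \<le> N + \<delta>" by (rule norm_le[OF f(1)])
        have "(\<Sum>i\<in>I. z i * g i) = f ?y + (\<Sum>i\<in>I. z i * (g i - f (u i)))"
          by (simp add: dual_sum[OF f(1)] right_diff_distrib sum_subtractf)
        then have "norm (\<Sum>i\<in>I. z i * g i) \<le> norm (f ?y) + norm (\<Sum>i\<in>I. z i * (g i - f (u i)))"
          by (simp add: norm_triangle_ineq)
        also have "norm (f ?y) \<le> (N + \<delta>) * norm ?y"
          using dual_bound[OF f(1)] mult_right_mono[OF nf] by (rule order_trans) simp
        also have "norm (\<Sum>i\<in>I. z i * (g i - f (u i))) \<le> (\<Sum>i\<in>I. norm (z i) * \<delta>)"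
          using I(2) f(2) by (intro sum_norm_le) (auto simp: norm_mult intro!: mult_left_mono)
        finally show ?thesis by (simp add: Z_def sum_distrib_left algebra_simps)
      qed
      show "norm (\<Sum>i\<in>I. z i * g i) \<le> N * norm ?y"
      proof (rule field_le_epsilon)
        fix \<epsilon> :: real assume \<epsilon>: "\<epsilon> > 0"
        \<comment> \<open>\<open>Z\<close> may be 0, hence the division by Z + 1.\<close>
        have "\<epsilon> / (Z + 1) * Z \<le> \<epsilon>" using \<epsilon> Z by (simp add: field_simps)
        then show "norm (\<Sum>i\<in>I. z i * g i) \<le> N * norm ?y + \<epsilon>"
          using *[of "\<epsilon> / (Z + 1)"] \<epsilon> Z by simp
      qed
    qed
    then obtain F where F: "F \<in> vcarrier D" "\<And>i. i \<in> Field \<eta> \<Longrightarrow> F (u i) = g i" by blast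
    have "T C = J F" using F(2) gL by (auto simp: J_def mem_linfty g_def)
    with F(1) C show ?thesis by (auto simp: S_def)
  qed
  have S_E: "\<exists>f\<in>vcarrier D. T C = J f" if "C \<in> S" for C using that by (auto simp: S_def)
  have S_Q: "C \<in> vcarrier Q" if "C \<in> S" for C using that by (auto simp: S_def)
  have S_add: "vadd Q C E \<in> S" if CE: "C \<in> S" "E \<in> S" for C E
  proof -
    obtain f g where "f \<in> vcarrier D" "T C = J f" "g \<in> vcarrier D" "T E = J g"
      using S_E[OF CE(1)] S_E[OF CE(2)] by blast
    then show ?thesis
      using CE by (auto simp: S_def Q_add_in T_add simp flip: J_add intro: dual_closed_add)
  qed
  have S_scale: "vscale Q c C \<in> S" if C: "C \<in> S" for c C
  proof -
    obtain f where "f \<in> vcarrier D" "T C = J f" using S_E[OF C] by blast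
    then show ?thesis
      using C by (auto simp: S_def Q_scale_in T_scale simp flip: J_scale intro: dual_closed_scale)
  qed
  have "\<exists>C\<in>S. T C = J f" if "f \<in> vcarrier D" for f
    using T_onto[OF J_in[OF that]] that by (auto simp: S_def)
  note S_onto = this
  have "closed_subspace Q S"
    unfolding closed_subspace_def
  proof (intro conjI ballI allI impI)
    have "(\<lambda>x. 0) \<in> vcarrier D" using zero_mem_WAP WAP_subset_dual by blast
    then show "S \<noteq> {}" using S_onto by blast
  qed (use S_Q S_add S_scale closed in auto)
  \<comment> \<open>On \<open>S\<close> the value of \<open>T\<close> lies in the range of
    \<open>J\<close>, and injectivity of \<open>J\<close> makes the chosen preimage unique, hence
    linear in \<open>C\<close>. Since \<open>J\<close> does not decrease norms, the bound of
    \<open>T\<close> is inherited.\<close>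
  moreover define T' where "T' = (\<lambda>C. inv_into (vcarrier D) J (T C))"
  have T'D: "T' C \<in> vcarrier D" and JT': "J (T' C) = T C" if "C \<in> S" for C
    using that unfolding T'_def S_def by (auto intro: inv_into_into simp: f_inv_into_f)
  have T'_eq: "T' C = f" if "C \<in> S" "f \<in> vcarrier D" "T C = J f" for C f
    using J_inj[OF T'D[OF that(1)] that(2)] JT'[OF that(1)] that(3) by simp
  have "bounded_linear_onto (restrict_space_to Q S) D T'"
    unfolding bounded_linear_onto_def bounded_linear_map_def restrict_space_to_def
  proof (simp, intro conjI ballI allI exI)
    show "T' ` S \<subseteq> vcarrier D" using T'D by auto
    show "T' ` S = vcarrier D"
    proof (intro equalityI subsetI)
      fix f assume f: "f \<in> vcarrier D"
      then obtain C where "C \<in> S" "T C = J f" using S_onto by blast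
      with T'_eq[OF _ f] show "f \<in> T' ` S" by blast
    qed (use T'D in auto)
    show "T' (vadd Q C E) = (\<lambda>x. T' C x + T' E x)" if "C \<in> S" "E \<in> S" for C E
      using that by (intro T'_eq) (auto simp: S_add dual_closed_add T'D T_add S_Q J_add JT')
    show "T' (vscale Q c C) = (\<lambda>x. c * T' C x)" if "C \<in> S" for c C
      using that by (intro T'_eq) (auto simp: S_scale dual_closed_scale T'D T_scale S_Q J_scale JT')
    show "vnorm D (T' C) \<le> C0 * vnorm Q C" if "C \<in> S" for C
      using J_norm[OF T'D[OF that]] C0[OF S_Q[OF that]] by (simp add: JT'[OF that])
  qed
  ultimately show ?thesis
    unfolding extremely_non_Arens_regular_def Let_def by blast
qed

text \<open>A bounded function on the base changes a combination's size by at most its bound times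
  the sum of the absolute coefficients, and the base inequality controls that sum. This is the
  hypothesis of Helly's theorem.\<close>

lemma l1_base_functional:
  assumes X: "l1_base smul \<eta> K X" and g: "\<And>x. x \<in> X \<Longrightarrow> norm (g x) \<le> C"
  shows "\<exists>F\<in>vcarrier D. \<forall>x\<in>X. F x = g x"
proof (rule Helly[where C = "\<bar>C\<bar> * K"])
  fix I :: "'a set" and z :: "'a \<Rightarrow> 'k" assume I: "finite I" "I \<subseteq> X"
  have "norm (\<Sum>x\<in>I. z x * g x) \<le> (\<Sum>x\<in>I. norm (z x) * \<bar>C\<bar>)"
  proof (rule sum_norm_le)
    fix x assume "x \<in> I"
    then have "norm (g x) \<le> \<bar>C\<bar>" using g[of x] I(2) by auto
    then show "norm (z x * g x) \<le> norm (z x) * \<bar>C\<bar>" by (simp add: norm_mult mult_left_mono)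
  qed
  also have "\<dots> = \<bar>C\<bar> * (\<Sum>x\<in>I. norm (z x))" by (simp add: sum_distrib_left mult.commute)
  also have "\<dots> \<le> \<bar>C\<bar> * (K * norm (\<Sum>x\<in>I. smul (z x) x))"
    using X I by (intro mult_left_mono) (auto simp: l1_base_def)
  finally show "norm (\<Sum>x\<in>I. z x * g x) \<le> \<bar>C\<bar> * K * norm (\<Sum>x\<in>I. smul (z x) x)"
    by (simp add: mult.assoc)
qed

text \<open>Values prescribed on index pairs descend to \<open>X\<^sub>1\<close> when they agree on
  pairs naming the same element. Disjointness of \<open>X\<^sub>1\<close> and
  \<open>X\<^sub>2\<close> leaves room to prescribe 0 on \<open>X\<^sub>2\<close>.\<close>

lemma double_indexed_functional:
  assumes X: "l1_base smul \<eta> K (X\<^sub>1 \<union> X\<^sub>2)" "X\<^sub>1 \<inter> X\<^sub>2 = {}"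
    and ind: "double_indexed X\<^sub>1 U\<^sub>1 x\<^sub>1" "double_indexed X\<^sub>2 U\<^sub>2 x\<^sub>2"
    and inj: "\<And>\<alpha> \<beta> \<alpha>' \<beta>'. (\<alpha>, \<beta>) \<in> U\<^sub>1 \<Longrightarrow> (\<alpha>', \<beta>') \<in> U\<^sub>1 \<Longrightarrow> x\<^sub>1 \<alpha> \<beta> = x\<^sub>1 \<alpha>' \<beta>' \<Longrightarrow> w \<alpha> \<beta> = w \<alpha>' \<beta>'"
    and C: "\<And>\<alpha> \<beta>. norm (w \<alpha> \<beta>) \<le> C"
  shows "\<exists>F\<in>vcarrier D. (\<forall>\<alpha> \<beta>. (\<alpha>, \<beta>) \<in> U\<^sub>1 \<longrightarrow> F (x\<^sub>1 \<alpha> \<beta>) = w \<alpha> \<beta>) \<and>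
     (\<forall>\<alpha> \<beta>. (\<alpha>, \<beta>) \<in> U\<^sub>2 \<longrightarrow> F (x\<^sub>2 \<alpha> \<beta>) = 0)"
proof -
  define s where "s y = (SOME p. p \<in> U\<^sub>1 \<and> x\<^sub>1 (fst p) (snd p) = y)" for y
  define g where "g y = (if y \<in> X\<^sub>1 then w (fst (s y)) (snd (s y)) else 0)" for y
  \<comment> \<open>Any single value of \<open>w\<close> shows that \<open>C\<close> is nonnegative,
    as required where \<open>g\<close> is 0.\<close>
  have "norm (w undefined undefined) \<le> C" by (rule C)
  then have "0 \<le> C" by (rule order_trans[OF norm_ge_zero])
  then have "norm (g y) \<le> C" for y using C by (simp add: g_def)
  then obtain F where F: "F \<in> vcarrier D" "\<And>x. x \<in> X\<^sub>1 \<union> X\<^sub>2 \<Longrightarrow> F x = g x"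
    using l1_base_functional[OF X(1), of g C] by blast
  have "F (x\<^sub>1 \<alpha> \<beta>) = w \<alpha> \<beta>" if U: "(\<alpha>, \<beta>) \<in> U\<^sub>1" for \<alpha> \<beta>
  proof -
    have "\<exists>p. p \<in> U\<^sub>1 \<and> x\<^sub>1 (fst p) (snd p) = x\<^sub>1 \<alpha> \<beta>" using U by (intro exI[of _ "(\<alpha>, \<beta>)"]) simp
    then have "s (x\<^sub>1 \<alpha> \<beta>) \<in> U\<^sub>1 \<and> x\<^sub>1 (fst (s (x\<^sub>1 \<alpha> \<beta>))) (snd (s (x\<^sub>1 \<alpha> \<beta>))) = x\<^sub>1 \<alpha> \<beta>"
      unfolding s_def by (rule someI_ex)
    then have "w (fst (s (x\<^sub>1 \<alpha> \<beta>))) (snd (s (x\<^sub>1 \<alpha> \<beta>))) = w \<alpha> \<beta>"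
      using U by (intro inj) auto
    moreover have "x\<^sub>1 \<alpha> \<beta> \<in> X\<^sub>1" using ind(1) U by (force simp: double_indexed_def)
    ultimately show ?thesis using F(2) by (simp add: g_def)
  qed
  moreover have "F (x\<^sub>2 \<alpha> \<beta>) = 0" if "(\<alpha>, \<beta>) \<in> U\<^sub>2" for \<alpha> \<beta>
  proof -
    have "x\<^sub>2 \<alpha> \<beta> \<in> X\<^sub>2" using ind(2) that by (force simp: double_indexed_def)
    then show ?thesis using F(2) X(2) by (auto simp: g_def)
  qed
  ultimately show ?thesis using F(1) by blast
qed

end

text \<open>The label of an index is the coordinate of \<open>c\<close> belonging to its piece, and
  0 outside all pieces. Disjointness makes the piece unique.\<close>

lemma disjoint_family_labelling:
  assumes c: "c \<in> vcarrier (linfty \<eta>)"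
    and disj: "\<And>i j. i \<in> Field \<eta> \<Longrightarrow> j \<in> Field \<eta> \<Longrightarrow> i \<noteq> j \<Longrightarrow> P i \<inter> P j = {}"
  shows "\<exists>l C. (\<forall>i \<alpha>. i \<in> Field \<eta> \<longrightarrow> \<alpha> \<in> P i \<longrightarrow> l \<alpha> = c i) \<and> (\<forall>\<alpha>. norm (l \<alpha>) \<le> C)"
proof -
  obtain C where C: "\<And>i. i \<in> Field \<eta> \<Longrightarrow> norm (c i) \<le> C" using c unfolding mem_linfty by blast
  define l where "l \<alpha> = (if \<exists>i\<in>Field \<eta>. \<alpha> \<in> P i then c (SOME i. i \<in> Field \<eta> \<and> \<alpha> \<in> P i) else 0)" for \<alpha>
  have some: "(SOME i. i \<in> Field \<eta> \<and> \<alpha> \<in> P i) = i" if "i \<in> Field \<eta>" "\<alpha> \<in> P i" for i \<alpha>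
    using that disj by (intro some_equality) blast+
  have l: "l \<alpha> = c i" if "i \<in> Field \<eta>" "\<alpha> \<in> P i" for i \<alpha>
    using that some[OF that] by (auto simp: l_def)
  have "norm (l \<alpha>) \<le> \<bar>C\<bar>" for \<alpha>
  proof (cases "\<exists>i\<in>Field \<eta>. \<alpha> \<in> P i")
    case True
    then obtain i where "i \<in> Field \<eta>" "\<alpha> \<in> P i" by blast
    with l C[of i] show ?thesis by auto
  qed (simp add: l_def)
  with l show ?thesis by blast
qed

section \<open>Iterated limits of functionals prescribed on the two triangles\<close>

locale approximated_segments = banach_algebra smul
  for smul :: "'k::real_or_complex \<Rightarrow> 'a::{real_normed_algebra, banach} \<Rightarrow> 'a" +
  fixes \<Lambda> \<Lambda>\<^sub>1 \<Lambda>\<^sub>2 :: "'i set" and r :: "'i rel" and a b :: "'i \<Rightarrow> 'a"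
    and X\<^sub>1 X\<^sub>2 :: "'a set" and U\<^sub>1 U\<^sub>2 :: "('i \<times> 'i) set" and x\<^sub>1 x\<^sub>2 :: "'i \<Rightarrow> 'i \<Rightarrow> 'a"
  assumes dir: "directed_set \<Lambda> r"
    and cof\<^sub>1: "cofinal_subset \<Lambda> r \<Lambda>\<^sub>1" and cof\<^sub>2: "cofinal_subset \<Lambda> r \<Lambda>\<^sub>2"
    and upper: "approximates_upper_segments r \<Lambda>\<^sub>1 \<Lambda>\<^sub>2 a b X\<^sub>1 U\<^sub>1 x\<^sub>1"
    and lower: "approximates_lower_segments r \<Lambda>\<^sub>1 \<Lambda>\<^sub>2 a b X\<^sub>2 U\<^sub>2 x\<^sub>2"
begin

lemma eventually_upper: "\<alpha> \<in> \<Lambda>\<^sub>1 \<Longrightarrow> \<forall>\<^sub>F \<beta> in tails_filter \<Lambda>\<^sub>2 r. (\<alpha>, \<beta>) \<in> U\<^sub>1"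
  using upper unfolding eventually_tails_filter[OF dir cof\<^sub>2]
  by (auto simp: approximates_upper_segments_def vertically_cofinal_def)

lemma eventually_lower: "\<beta> \<in> \<Lambda>\<^sub>2 \<Longrightarrow> \<forall>\<^sub>F \<alpha> in tails_filter \<Lambda>\<^sub>1 r. (\<alpha>, \<beta>) \<in> U\<^sub>2"
  using lower unfolding eventually_tails_filter[OF dir cof\<^sub>1]
  by (auto simp: approximates_lower_segments_def horizontally_cofinal_def)

text \<open>Values need only be known at pairs in \<open>U\<^sub>1\<close>, because vertical
  cofinality puts (\<alpha>, \<beta>) there for all large \<beta>.\<close>

lemma tendsto_upper:
  assumes F: "F \<in> vcarrier D" and \<alpha>: "\<alpha> \<in> \<Lambda>\<^sub>1" and V: "V \<le> tails_filter \<Lambda>\<^sub>2 r"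
    and c: "\<forall>\<^sub>F \<beta> in V. (\<alpha>, \<beta>) \<in> U\<^sub>1 \<longrightarrow> F (x\<^sub>1 \<alpha> \<beta>) = c"
  shows "((\<lambda>\<beta>. F (a \<alpha> * b \<beta>)) \<longlongrightarrow> c) V"
proof (rule tendsto_dual[OF F])
  show "((\<lambda>\<beta>. norm (x\<^sub>1 \<alpha> \<beta> - a \<alpha> * b \<beta>)) \<longlongrightarrow> 0) V"
    using upper \<alpha> tendsto_mono[OF V] by (auto simp: approximates_upper_segments_def)
  have "\<forall>\<^sub>F \<beta> in V. F (x\<^sub>1 \<alpha> \<beta>) = c"
    using filter_leD[OF V eventually_upper[OF \<alpha>]] c by eventually_elim simp
  then show "((\<lambda>\<beta>. F (x\<^sub>1 \<alpha> \<beta>)) \<longlongrightarrow> c) V" by (rule tendsto_eventually)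
qed

lemma tendsto_lower:
  assumes F: "F \<in> vcarrier D" and \<beta>: "\<beta> \<in> \<Lambda>\<^sub>2" and U: "U \<le> tails_filter \<Lambda>\<^sub>1 r"
    and c: "\<And>\<alpha>. (\<alpha>, \<beta>) \<in> U\<^sub>2 \<Longrightarrow> F (x\<^sub>2 \<alpha> \<beta>) = c"
  shows "((\<lambda>\<alpha>. F (a \<alpha> * b \<beta>)) \<longlongrightarrow> c) U"
proof (rule tendsto_dual[OF F])
  show "((\<lambda>\<alpha>. norm (x\<^sub>2 \<alpha> \<beta> - a \<alpha> * b \<beta>)) \<longlongrightarrow> 0) U"
    using lower \<beta> tendsto_mono[OF U] by (auto simp: approximates_lower_segments_def)
  have "\<forall>\<^sub>F \<alpha> in U. F (x\<^sub>2 \<alpha> \<beta>) = c"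
    using filter_leD[OF U eventually_lower[OF \<beta>]] by eventually_elim (rule c)
  then show "((\<lambda>\<alpha>. F (x\<^sub>2 \<alpha> \<beta>)) \<longlongrightarrow> c) U" by (rule tendsto_eventually)
qed

lemma
  shows eventually_mem_\<Lambda>\<^sub>1: "U \<le> tails_filter \<Lambda>\<^sub>1 r \<Longrightarrow> \<forall>\<^sub>F \<alpha> in U. \<alpha> \<in> \<Lambda>\<^sub>1"
    and eventually_mem_\<Lambda>\<^sub>2: "V \<le> tails_filter \<Lambda>\<^sub>2 r \<Longrightarrow> \<forall>\<^sub>F \<beta> in V. \<beta> \<in> \<Lambda>\<^sub>2"
proof -
  have "\<forall>\<^sub>F \<alpha> in tails_filter \<Lambda>\<^sub>1 r. \<alpha> \<in> \<Lambda>\<^sub>1" "\<forall>\<^sub>F \<beta> in tails_filter \<Lambda>\<^sub>2 r. \<beta> \<in> \<Lambda>\<^sub>2"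
    using cofinal_not_empty[OF dir cof\<^sub>1] cofinal_not_empty[OF dir cof\<^sub>2]
    unfolding eventually_tails_filter[OF dir cof\<^sub>1] eventually_tails_filter[OF dir cof\<^sub>2] by blast+
  then show "U \<le> tails_filter \<Lambda>\<^sub>1 r \<Longrightarrow> \<forall>\<^sub>F \<alpha> in U. \<alpha> \<in> \<Lambda>\<^sub>1"
    "V \<le> tails_filter \<Lambda>\<^sub>2 r \<Longrightarrow> \<forall>\<^sub>F \<beta> in V. \<beta> \<in> \<Lambda>\<^sub>2"
    by (blast intro: filter_leD)+
qed

text \<open>With \<alpha> fixed the inner limit over \<beta> is read off \<open>X\<^sub>1\<close>
  and is \<open>c\<close>; with \<beta> fixed the inner limit over \<alpha> is read off
  \<open>X\<^sub>2\<close> and is 0.\<close>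

lemma limit_gap_eq:
  assumes F: "F \<in> vcarrier D"
    and U: "ultrafilter U" "U \<le> tails_filter \<Lambda>\<^sub>1 r" and V: "ultrafilter V" "V \<le> tails_filter \<Lambda>\<^sub>2 r"
    and c: "\<forall>\<^sub>F \<alpha> in U. \<forall>\<^sub>F \<beta> in V. (\<alpha>, \<beta>) \<in> U\<^sub>1 \<longrightarrow> F (x\<^sub>1 \<alpha> \<beta>) = c"
    and 0: "\<And>\<alpha> \<beta>. (\<alpha>, \<beta>) \<in> U\<^sub>2 \<Longrightarrow> F (x\<^sub>2 \<alpha> \<beta>) = 0"
  shows "limit_gap a b U V F = c"
proof -
  have "\<forall>\<^sub>F \<alpha> in U. ((\<lambda>\<beta>. F (a \<alpha> * b \<beta>)) \<longlongrightarrow> c) V"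
    using eventually_mem_\<Lambda>\<^sub>1[OF U(2)] c by eventually_elim (rule tendsto_upper[OF F _ V(2)])
  then have "ulim2 U V (\<lambda>\<alpha> \<beta>. F (a \<alpha> * b \<beta>)) = c" by (rule ulim2_eq[OF U(1) V(1)])
  moreover have "\<forall>\<^sub>F \<beta> in V. ((\<lambda>\<alpha>. F (a \<alpha> * b \<beta>)) \<longlongrightarrow> 0) U"
    using eventually_mem_\<Lambda>\<^sub>2[OF V(2)] by eventually_elim (rule tendsto_lower[OF F _ U(2) 0])
  then have "ulim2 V U (\<lambda>\<beta> \<alpha>. F (a \<alpha> * b \<beta>)) = 0" by (rule ulim2_eq[OF V(1) U(1)])
  ultimately show ?thesis by (simp add: limit_gap_def)
qed

text \<open>Vertical injectivity lets a functional on \<open>X\<^sub>1\<close> depend on \<beta>, so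
  the pieces are taken in \<open>\<Lambda>\<^sub>2\<close> and the ultrafilter on
  \<open>\<Lambda>\<^sub>1\<close> is fixed. Horizontal injectivity exchanges the two index
  sets.\<close>

theorem linfty_image_of_quotient:
  fixes \<eta> :: "'c rel"
  assumes \<eta>: "Cinfinite \<eta>"
    and tr: "true_cardinality \<Lambda>\<^sub>1 r =o \<eta>" "true_cardinality \<Lambda>\<^sub>2 r =o \<eta>"
    and bounded: "bounded (a ` \<Lambda>\<^sub>1)" "bounded (b ` \<Lambda>\<^sub>2)"
    and X: "l1_base smul \<eta> K (X\<^sub>1 \<union> X\<^sub>2)" "X\<^sub>1 \<inter> X\<^sub>2 = {}"
    and inj: "vertically_injective U\<^sub>1 x\<^sub>1 \<or> horizontally_injective U\<^sub>1 x\<^sub>1"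
  shows "\<exists>T. bounded_linear_onto Q (linfty \<eta> :: ('k, 'c \<Rightarrow> 'k) nspace) T"
proof -
  have ind: "double_indexed X\<^sub>1 U\<^sub>1 x\<^sub>1" "double_indexed X\<^sub>2 U\<^sub>2 x\<^sub>2"
    using upper lower by (simp_all add: approximates_upper_segments_def approximates_lower_segments_def)
  have ne: "Field \<eta> \<noteq> {}" using \<eta> by (auto simp: cinfinite_def)
  obtain R where R: "\<And>\<alpha>. \<alpha> \<in> \<Lambda>\<^sub>1 \<Longrightarrow> norm (a \<alpha>) \<le> R" using bounded(1) by (auto simp: bounded_iff)
  obtain R' where R': "\<And>\<beta>. \<beta> \<in> \<Lambda>\<^sub>2 \<Longrightarrow> norm (b \<beta>) \<le> R'" using bounded(2) by (auto simp: bounded_iff)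
  have a: "\<forall>\<^sub>F \<alpha> in U. norm (a \<alpha>) \<le> R" if "U \<le> tails_filter \<Lambda>\<^sub>1 r" for U
    using eventually_mem_\<Lambda>\<^sub>1[OF that] by eventually_elim (rule R)
  have b: "\<forall>\<^sub>F \<beta> in V. norm (b \<beta>) \<le> R'" if "V \<le> tails_filter \<Lambda>\<^sub>2 r" for V
    using eventually_mem_\<Lambda>\<^sub>2[OF that] by eventually_elim (rule R')
  have "\<exists>U. ultrafilter U \<and> U \<le> tails_filter \<Lambda>\<^sub>1 r"
    using ultrafilter_on_cofinal_set[OF dir cof\<^sub>1, of \<Lambda>\<^sub>1] cofinal_refl[OF dir cof\<^sub>1] by metis
  then obtain U0 where U0: "ultrafilter U0" "U0 \<le> tails_filter \<Lambda>\<^sub>1 r" by blast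
  have "\<exists>V. ultrafilter V \<and> V \<le> tails_filter \<Lambda>\<^sub>2 r"
    using ultrafilter_on_cofinal_set[OF dir cof\<^sub>2, of \<Lambda>\<^sub>2] cofinal_refl[OF dir cof\<^sub>2] by metis
  then obtain V0 where V0: "ultrafilter V0" "V0 \<le> tails_filter \<Lambda>\<^sub>2 r" by blast
  from inj show ?thesis
  proof
    assume v: "vertically_injective U\<^sub>1 x\<^sub>1"
    obtain P where P: "\<And>i. i \<in> Field \<eta> \<Longrightarrow> P i \<subseteq> \<Lambda>\<^sub>2"
      "\<And>i \<xi>. i \<in> Field \<eta> \<Longrightarrow> \<xi> \<in> \<Lambda>\<^sub>2 \<Longrightarrow> \<exists>\<alpha>\<in>P i. (\<xi>, \<alpha>) \<in> r"
      "\<And>i j. i \<in> Field \<eta> \<Longrightarrow> j \<in> Field \<eta> \<Longrightarrow> i \<noteq> j \<Longrightarrow> P i \<inter> P j = {}"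
      using disjoint_cofinal_family[OF \<eta> dir cof\<^sub>2 tr(2)] by metis
    have "\<exists>V. ultrafilter V \<and> V \<le> tails_filter \<Lambda>\<^sub>2 r \<and> (\<forall>\<^sub>F \<beta> in V. \<beta> \<in> P i)" if i: "i \<in> Field \<eta>" for i
      using ultrafilter_on_cofinal_set[OF dir cof\<^sub>2, of "P i"] P(1,2)[OF i] by (metis subsetD)
    then obtain V where V: "\<And>i. i \<in> Field \<eta> \<Longrightarrow> ultrafilter (V i)"
      "\<And>i. i \<in> Field \<eta> \<Longrightarrow> V i \<le> tails_filter \<Lambda>\<^sub>2 r"
      "\<And>i. i \<in> Field \<eta> \<Longrightarrow> \<forall>\<^sub>F \<beta> in V i. \<beta> \<in> P i" by metis
    show ?thesis
    proof (rule limit_gaps_onto_linfty[where U = "\<lambda>i. U0" and V = V, OF ne U0(1) V(1) a[OF U0(2)] b[OF V(2)]])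
      fix c :: "'c \<Rightarrow> 'k" assume c: "c \<in> vcarrier (linfty \<eta>)"
      obtain l C where l: "\<And>i \<alpha>. i \<in> Field \<eta> \<Longrightarrow> \<alpha> \<in> P i \<Longrightarrow> l \<alpha> = c i" "\<And>\<alpha>. norm (l \<alpha>) \<le> C"
        using disjoint_family_labelling[of c \<eta> P, OF c P(3)] by blast
      have "\<exists>F\<in>vcarrier D. (\<forall>\<alpha> \<beta>. (\<alpha>, \<beta>) \<in> U\<^sub>1 \<longrightarrow> F (x\<^sub>1 \<alpha> \<beta>) = l \<beta>) \<and>
          (\<forall>\<alpha> \<beta>. (\<alpha>, \<beta>) \<in> U\<^sub>2 \<longrightarrow> F (x\<^sub>2 \<alpha> \<beta>) = 0)"
        using v l(2) by (intro double_indexed_functional[OF X ind]) (fastforce simp: vertically_injective_def)+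
      then obtain F where F: "F \<in> vcarrier D" "\<And>\<alpha> \<beta>. (\<alpha>, \<beta>) \<in> U\<^sub>1 \<Longrightarrow> F (x\<^sub>1 \<alpha> \<beta>) = l \<beta>"
        "\<And>\<alpha> \<beta>. (\<alpha>, \<beta>) \<in> U\<^sub>2 \<Longrightarrow> F (x\<^sub>2 \<alpha> \<beta>) = 0" by blast
      have "limit_gap a b U0 (V i) F = c i" if i: "i \<in> Field \<eta>" for i
      proof (rule limit_gap_eq[OF F(1) U0 V(1,2)[OF i] _ F(3)])
        \<comment> \<open>The label depends on the inner index, so this holds for each \<alpha>
          separately.\<close>
        have "\<forall>\<^sub>F \<beta> in V i. (\<alpha>, \<beta>) \<in> U\<^sub>1 \<longrightarrow> F (x\<^sub>1 \<alpha> \<beta>) = c i" for \<alpha>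
          using V(3)[OF i] by eventually_elim (use F(2) l(1)[OF i] in simp)
        then show "\<forall>\<^sub>F \<alpha> in U0. \<forall>\<^sub>F \<beta> in V i. (\<alpha>, \<beta>) \<in> U\<^sub>1 \<longrightarrow> F (x\<^sub>1 \<alpha> \<beta>) = c i" by simp
      qed
      with F(1) show "\<exists>F\<in>vcarrier D. \<forall>i\<in>Field \<eta>. limit_gap a b U0 (V i) F = c i" by blast
    qed
  next
    assume h: "horizontally_injective U\<^sub>1 x\<^sub>1"
    obtain P where P: "\<And>i. i \<in> Field \<eta> \<Longrightarrow> P i \<subseteq> \<Lambda>\<^sub>1"
      "\<And>i \<xi>. i \<in> Field \<eta> \<Longrightarrow> \<xi> \<in> \<Lambda>\<^sub>1 \<Longrightarrow> \<exists>\<alpha>\<in>P i. (\<xi>, \<alpha>) \<in> r"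
      "\<And>i j. i \<in> Field \<eta> \<Longrightarrow> j \<in> Field \<eta> \<Longrightarrow> i \<noteq> j \<Longrightarrow> P i \<inter> P j = {}"
      using disjoint_cofinal_family[OF \<eta> dir cof\<^sub>1 tr(1)] by metis
    have "\<exists>U. ultrafilter U \<and> U \<le> tails_filter \<Lambda>\<^sub>1 r \<and> (\<forall>\<^sub>F \<alpha> in U. \<alpha> \<in> P i)" if i: "i \<in> Field \<eta>" for i
      using ultrafilter_on_cofinal_set[OF dir cof\<^sub>1, of "P i"] P(1,2)[OF i] by (metis subsetD)
    then obtain U where U: "\<And>i. i \<in> Field \<eta> \<Longrightarrow> ultrafilter (U i)"
      "\<And>i. i \<in> Field \<eta> \<Longrightarrow> U i \<le> tails_filter \<Lambda>\<^sub>1 r"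
      "\<And>i. i \<in> Field \<eta> \<Longrightarrow> \<forall>\<^sub>F \<alpha> in U i. \<alpha> \<in> P i" by metis
    show ?thesis
    proof (rule limit_gaps_onto_linfty[where U = U and V = "\<lambda>i. V0", OF ne U(1) V0(1) a[OF U(2)] b[OF V0(2)]])
      fix c :: "'c \<Rightarrow> 'k" assume c: "c \<in> vcarrier (linfty \<eta>)"
      obtain l C where l: "\<And>i \<alpha>. i \<in> Field \<eta> \<Longrightarrow> \<alpha> \<in> P i \<Longrightarrow> l \<alpha> = c i" "\<And>\<alpha>. norm (l \<alpha>) \<le> C"
        using disjoint_family_labelling[of c \<eta> P, OF c P(3)] by blast
      have "\<exists>F\<in>vcarrier D. (\<forall>\<alpha> \<beta>. (\<alpha>, \<beta>) \<in> U\<^sub>1 \<longrightarrow> F (x\<^sub>1 \<alpha> \<beta>) = l \<alpha>) \<and>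
          (\<forall>\<alpha> \<beta>. (\<alpha>, \<beta>) \<in> U\<^sub>2 \<longrightarrow> F (x\<^sub>2 \<alpha> \<beta>) = 0)"
        using h l(2) by (intro double_indexed_functional[OF X ind]) (fastforce simp: horizontally_injective_def)+
      then obtain F where F: "F \<in> vcarrier D" "\<And>\<alpha> \<beta>. (\<alpha>, \<beta>) \<in> U\<^sub>1 \<Longrightarrow> F (x\<^sub>1 \<alpha> \<beta>) = l \<alpha>"
        "\<And>\<alpha> \<beta>. (\<alpha>, \<beta>) \<in> U\<^sub>2 \<Longrightarrow> F (x\<^sub>2 \<alpha> \<beta>) = 0" by blast
      have "limit_gap a b (U i) V0 F = c i" if i: "i \<in> Field \<eta>" for i
      proof (rule limit_gap_eq[OF F(1) U(1,2)[OF i] V0 _ F(3)])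
        \<comment> \<open>Now the label depends on the outer index: once \<alpha> lies in the piece,
          the value is right for every \<beta>.\<close>
        show "\<forall>\<^sub>F \<alpha> in U i. \<forall>\<^sub>F \<beta> in V0. (\<alpha>, \<beta>) \<in> U\<^sub>1 \<longrightarrow> F (x\<^sub>1 \<alpha> \<beta>) = c i"
          using U(3)[OF i] by eventually_elim (use F(2) l(1)[OF i] in simp)
      qed
      with F(1) show "\<exists>F\<in>vcarrier D. \<forall>i\<in>Field \<eta>. limit_gap a b (U i) V0 F = c i" by blast
    qed
  qed
qed

end

theorem corollary3p10:
  fixes smul :: "'k::real_or_complex \<Rightarrow> 'a::{real_normed_algebra, banach} \<Rightarrow> 'a"
    and \<eta> :: "'c rel"
    and \<Lambda> \<Lambda>\<^sub>1 \<Lambda>\<^sub>2 :: "'i set" and r :: "'i rel"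
    and a b :: "'i \<Rightarrow> 'a"
    and X\<^sub>1 X\<^sub>2 :: "'a set"
    and U\<^sub>1 U\<^sub>2 :: "('i \<times> 'i) set" and x\<^sub>1 x\<^sub>2 :: "'i \<Rightarrow> 'i \<Rightarrow> 'a"
    and K M :: real
  assumes "banach_algebra smul"
    and "Cinfinite \<eta>"
    and "directed_set \<Lambda> r" "cofinal_subset \<Lambda> r \<Lambda>\<^sub>1" "cofinal_subset \<Lambda> r \<Lambda>\<^sub>2"
    and "true_cardinality \<Lambda>\<^sub>1 r =o \<eta>" "true_cardinality \<Lambda>\<^sub>2 r =o \<eta>"
    and "bounded (a ` \<Lambda>\<^sub>1)" "bounded (b ` \<Lambda>\<^sub>2)"
    and "X\<^sub>1 \<inter> X\<^sub>2 = {}"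
    and "K > 0" "l1_base smul \<eta> K (X\<^sub>1 \<union> X\<^sub>2)"
    and "M > 0" "X\<^sub>1 \<union> X\<^sub>2 \<subseteq> cball 0 M"
    and "approximates_upper_segments r \<Lambda>\<^sub>1 \<Lambda>\<^sub>2 a b X\<^sub>1 U\<^sub>1 x\<^sub>1"
    and "approximates_lower_segments r \<Lambda>\<^sub>1 \<Lambda>\<^sub>2 a b X\<^sub>2 U\<^sub>2 x\<^sub>2"
    and "(vertically_injective U\<^sub>1 x\<^sub>1 \<and> horizontally_injective U\<^sub>2 x\<^sub>2) \<or>
         (horizontally_injective U\<^sub>1 x\<^sub>1 \<and> vertically_injective U\<^sub>2 x\<^sub>2)"
  shows "(\<exists>T. bounded_linear_onto
               (quotient_space (algebra_dual smul) (WAP smul))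
               (linfty \<eta> :: ('k, 'c \<Rightarrow> 'k) nspace) T) \<and>
         (density_character (UNIV :: 'a set) \<le>o \<eta> \<longrightarrow> extremely_non_Arens_regular smul)"
proof -
  interpret approximated_segments smul \<Lambda> \<Lambda>\<^sub>1 \<Lambda>\<^sub>2 r a b X\<^sub>1 X\<^sub>2 U\<^sub>1 U\<^sub>2 x\<^sub>1 x\<^sub>2
    by (intro approximated_segments.intro approximated_segments_axioms.intro assms)
  have "\<exists>T. bounded_linear_onto (quotient_space (algebra_dual smul) (WAP smul))
      (linfty \<eta> :: ('k, 'c \<Rightarrow> 'k) nspace) T"
    using assms by (intro linfty_image_of_quotient) auto
  with linfty_onto_imp_extremely_non_Arens_regular[OF \<open>Cinfinite \<eta>\<close>] show ?thesis by blast
qed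

end
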